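(* Let $m\in\mathbb{N}$, $0<\delta<\min\{1, n/m\}$, $b\in\Lambda(\delta)$ and let $T$ be a Calderón-Zygmund singular integral operator on $\mathbb{R}^n$. Let $q=n/(n-m\delta)$, let $u\in A_1$ be a weight on $\mathbb{R}^n$ and let $v(x)=|x|^\beta$ with $\beta<-n$. Then there exists a positive constant $C$ such that the inequality \[uv^q\left(\left\{x\in\mathbb{R}^n: \frac{|T_b^m(fv)(x)|}{v(x)}>t\right\}\right)^{1/q}\leq \frac{C}{t}\,\|b\|_{\Lambda(\delta)}^m\int_{\mathbb{R}^n}|f(x)|\,u^{1/q}(x)\,v(x)\,dx\] holds for every $t>0$ and every bounded (measurable) function $f$ with compact support.
   Context: A weight is a locally integrable function $w$ on $\mathbb{R}^n$ with $0<w(x)<\infty$ for almost every $x$. For a nonnegative measurable function $w$ and a measurable set $E$, $w(E)=\int_E w(x)\,dx$; thus $uv^q(E)=\int_E u(x)v(x)^q\,dx$. Cubes have sides parallel to the coordinate axes. A weight $w$ belongs to $A_1$ if there is a constant $C>0$ with $\frac1{|Q|}\int_Q w\leq C\inf_Q w$ (essential infimum) for every cube $Q\subseteq\mathbb{R}^n$. For $0<\delta\leq 1$, a locally integrable function $b$ belongs to $\Lambda(\delta)$ if there is a constant $C>0$ with $|b(x)-b(y)|\leq C|x-y|^\delta$ for every $x,y\in\mathbb{R}^n$; the smallest such $C$ is denoted $\|b\|_{\Lambda(\delta)}$. A Calderón-Zygmund operator is a linear operator $T$ bounded on $L^2(\mathbb{R}^n)$ such that for $f\in L^2$ with compact support $Tf(x)=\int_{\mathbb{R}^n}K(x,y)f(y)\,dy$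 for $x\notin\mathrm{supp}\,f$, where $K:\mathbb{R}^n\times\mathbb{R}^n\setminus\Delta\to\mathbb{C}$ ($\Delta$ the diagonal) is measurable and is a standard kernel, i.e. for some constant $c$: $|K(x,y)|\leq c|x-y|^{-n}$; $|K(x,y)-K(x,z)|\leq c\frac{|y-z|}{|x-y|^{n+1}}$ if $|x-y|>2|y-z|$; and $|K(x,y)-K(w,y)|\leq c\frac{|x-w|}{|x-y|^{n+1}}$ if $|x-y|>2|x-w|$. $T$ is a Calderón-Zygmund singular integral operator if moreover $Tf(x)=\lim_{\varepsilon\to0}\int_{|y-x|>\varepsilon}K(x,y)f(y)\,dy$. The commutator of $T$ with symbol $b$ is $T_bf=[b,T]f=bTf-T(bf)$, and the higher order commutators are given recursively by $T_b^1=T_b$ and $T_b^m=[b,T_b^{m-1}]$ for $m\ge 2$. *)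

theory Defs
  imports "HOL-Analysis.Analysis" "HOL-Probability.Essential_Supremum"
begin

section \<open>Weights\<close>

definition locally_integrable :: "(real ^ 'n \<Rightarrow> 'b::{banach, second_countable_topology}) \<Rightarrow> bool" where
  "locally_integrable f \<longleftrightarrow> (\<forall>S. compact S \<longrightarrow> set_integrable lebesgue S f)"

text \<open>A weight is finite almost everywhere, so it is represented by a real-valued function;
  on the exceptional null set its values are irrelevant.\<close>

definition weight :: "(real ^ 'n \<Rightarrow> real) \<Rightarrow> bool" where
  "weight w \<longleftrightarrow> locally_integrable w \<and> (AE x in lebesgue. 0 < w x)"

definition weighted_measure :: "(real ^ 'n \<Rightarrow> real) \<Rightarrow> (real ^ 'n) set \<Rightarrow> ennreal" where
  "weighted_measure w E = (\<integral>\<^sup>+x\<in>E. ennreal (w x) \<partial>lebesgue)"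

definition cube :: "(real ^ 'n) set \<Rightarrow> bool" where
  "cube Q \<longleftrightarrow> (\<exists>a l. 0 < l \<and> Q = cbox a (\<chi> i. a $ i + l))"

definition ess_inf_on :: "(real ^ 'n) set \<Rightarrow> (real ^ 'n \<Rightarrow> real) \<Rightarrow> ereal" where
  "ess_inf_on Q w = - esssup (lebesgue_on Q) (\<lambda>x. - ereal (w x))"

definition A1_weight :: "(real ^ 'n \<Rightarrow> real) \<Rightarrow> bool" where
  "A1_weight w \<longleftrightarrow> weight w \<and>
     (\<exists>C>0. \<forall>Q. cube Q \<longrightarrow>
        ereal ((LINT x:Q|lebesgue. w x) / measure lebesgue Q) \<le> ereal C * ess_inf_on Q w)"

text \<open>The power $a^p$ for $a \in [0,\infty]$ and $p > 0$.\<close>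

definition ennreal_powr :: "ennreal \<Rightarrow> real \<Rightarrow> ennreal" where
  "ennreal_powr a p = (if a = \<infinity> then \<infinity> else ennreal (enn2real a powr p))"

section \<open>The Lipschitz classes\<close>

definition Lip_space :: "real \<Rightarrow> (real ^ 'n \<Rightarrow> complex) set" where
  "Lip_space \<delta> = {b. 0 < \<delta> \<and> \<delta> \<le> 1 \<and> locally_integrable b \<and>
     (\<exists>C>0. \<forall>x y. norm (b x - b y) \<le> C * norm (x - y) powr \<delta>)}"

text \<open>An infimum rather than a minimum: for constant \<open>b\<close> the value is \<open>0\<close>,
  which is not attained by a positive constant.\<close>

definition Lip_norm :: "real \<Rightarrow> (real ^ 'n \<Rightarrow> complex) \<Rightarrow> real" where
  "Lip_norm \<delta> b = Inf {C. 0 < C \<and> (\<forall>x y. norm (b x - b y) \<le> C * norm (x - y) powr \<delta>)}"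

section \<open>Calderon-Zygmund operators\<close>

definition L2_functions :: "(real ^ 'n \<Rightarrow> complex) set" where
  "L2_functions = {f \<in> borel_measurable lebesgue. integrable lebesgue (\<lambda>x. (norm (f x))\<^sup>2)}"

definition L2_norm :: "(real ^ 'n \<Rightarrow> complex) \<Rightarrow> real" where
  "L2_norm f = sqrt (LINT x|lebesgue. (norm (f x))\<^sup>2)"

definition supp :: "(real ^ 'n \<Rightarrow> complex) \<Rightarrow> (real ^ 'n) set" where
  "supp f = closure {x. f x \<noteq> 0}"

definition standard_kernel :: "(real ^ 'n \<Rightarrow> real ^ 'n \<Rightarrow> complex) \<Rightarrow> bool" where
  "standard_kernel K \<longleftrightarrow>
     (\<lambda>(x, y). K x y) \<in> borel_measurable (lebesgue_on {(x, y). x \<noteq> y}) \<and>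
     (\<exists>c. (\<forall>x y. x \<noteq> y \<longrightarrow> norm (K x y) \<le> c / norm (x - y) ^ CARD('n)) \<and>
          (\<forall>x y z. norm (x - y) > 2 * norm (y - z) \<longrightarrow>
             norm (K x y - K x z) \<le> c * (norm (y - z) / norm (x - y) ^ (CARD('n) + 1))) \<and>
          (\<forall>x y w. norm (x - y) > 2 * norm (x - w) \<longrightarrow>
             norm (K x y - K w y) \<le> c * (norm (x - w) / norm (x - y) ^ (CARD('n) + 1))))"

text \<open>Operators act on representatives, so all identities between values are required almost
  everywhere; linearity and boundedness make \<open>T\<close> well defined on classes.\<close>

definition L2_bounded_linear ::
  "((real ^ 'n \<Rightarrow> complex) \<Rightarrow> real ^ 'n \<Rightarrow> complex) \<Rightarrow> bool" where
  "L2_bounded_linear T \<longleftrightarrow>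
     (\<forall>f\<in>L2_functions. T f \<in> L2_functions) \<and>
     (\<forall>f\<in>L2_functions. \<forall>g\<in>L2_functions. AE x in lebesgue. T (\<lambda>y. f y + g y) x = T f x + T g x) \<and>
     (\<forall>f\<in>L2_functions. \<forall>a. AE x in lebesgue. T (\<lambda>y. a * f y) x = a * T f x) \<and>
     (\<exists>B. \<forall>f\<in>L2_functions. L2_norm (T f) \<le> B * L2_norm f)"

definition CZ_operator ::
  "(real ^ 'n \<Rightarrow> real ^ 'n \<Rightarrow> complex) \<Rightarrow> ((real ^ 'n \<Rightarrow> complex) \<Rightarrow> real ^ 'n \<Rightarrow> complex) \<Rightarrow> bool" where
  "CZ_operator K T \<longleftrightarrow> standard_kernel K \<and> L2_bounded_linear T \<and>
     (\<forall>f\<in>L2_functions. compact (supp f) \<longrightarrow>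
        (AE x in lebesgue. x \<notin> supp f \<longrightarrow> T f x = (LINT y|lebesgue. K x y * f y)))"

text \<open>The truncated integrals have to exist as Lebesgue integrals: the integral of a
  non-integrable function is \<open>0\<close> in the library.\<close>

definition has_principal_value ::
  "(real ^ 'n \<Rightarrow> real ^ 'n \<Rightarrow> complex) \<Rightarrow> (real ^ 'n \<Rightarrow> complex) \<Rightarrow> real ^ 'n \<Rightarrow> complex \<Rightarrow> bool" where
  "has_principal_value K f x l \<longleftrightarrow>
     (\<forall>\<epsilon>>0. set_integrable lebesgue {y. norm (y - x) > \<epsilon>} (\<lambda>y. K x y * f y)) \<and>
     ((\<lambda>\<epsilon>. LINT y:{y. norm (y - x) > \<epsilon>}|lebesgue. K x y * f y) \<longlongrightarrow> l) (at_right 0)"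

definition principal_value ::
  "(real ^ 'n \<Rightarrow> real ^ 'n \<Rightarrow> complex) \<Rightarrow> (real ^ 'n \<Rightarrow> complex) \<Rightarrow> real ^ 'n \<Rightarrow> complex" where
  "principal_value K f x =
     (if \<exists>l. has_principal_value K f x l then THE l. has_principal_value K f x l else 0)"

text \<open>On $L^2$ the principal value exists and represents \<open>T f\<close> almost everywhere. The commutators
  are also applied to functions outside $L^2$ (such as \<open>f v\<close> for \<open>v\<close> singular at the origin), to
  which \<open>T\<close> is extended by the same principal value formula, with value \<open>0\<close> at the points where
  the principal value does not exist.\<close>

definition CZ_singular_integral_operator ::
  "((real ^ 'n \<Rightarrow> complex) \<Rightarrow> real ^ 'n \<Rightarrow> complex) \<Rightarrow> bool" where
  "CZ_singular_integral_operator T \<longleftrightarrow>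
     (\<exists>K. CZ_operator K T \<and>
          (\<forall>f\<in>L2_functions. AE x in lebesgue. has_principal_value K f x (T f x)) \<and>
          (\<forall>f\<in>borel_measurable lebesgue. AE x in lebesgue. T f x = principal_value K f x))"

section \<open>Commutators\<close>

definition commutator ::
  "(real ^ 'n \<Rightarrow> complex) \<Rightarrow> ((real ^ 'n \<Rightarrow> complex) \<Rightarrow> real ^ 'n \<Rightarrow> complex) \<Rightarrow>
   (real ^ 'n \<Rightarrow> complex) \<Rightarrow> real ^ 'n \<Rightarrow> complex" where
  "commutator b T f x = b x * T f x - T (\<lambda>y. b y * f y) x"

text \<open>The recursion is started at order \<open>0\<close> with \<open>T\<close> itself, so order \<open>1\<close> is \<open>commutator b T\<close>.\<close>

primrec higher_commutator ::
  "nat \<Rightarrow> (real ^ 'n \<Rightarrow> complex) \<Rightarrow> ((real ^ 'n \<Rightarrow> complex) \<Rightarrow> real ^ 'n \<Rightarrow> complex) \<Rightarrow>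
   (real ^ 'n \<Rightarrow> complex) \<Rightarrow> real ^ 'n \<Rightarrow> complex" where
  "higher_commutator 0 b T = T"
| "higher_commutator (Suc m) b T = commutator b (higher_commutator m b T)"

end

theory Submission
  imports Defs
begin

text \<open>
  At almost every \<open>x\<close> the commutator is bounded by \<open>c \<parallel>b\<parallel>\<^sup>m\<close> times the fractional integral of order
  \<open>\<alpha> = m \<delta>\<close> of \<open>|f| v\<close>, because the factor \<open>(b x - b y)\<^sup>m\<close> makes the kernel absolutely integrable. So it
  suffices to bound this fractional integral, divided by \<open>v\<close>, in weak \<open>L\<^sup>q(u v\<^sup>q)\<close>. As \<open>q > 1\<close>, weak
  \<open>L\<^sup>q\<close> satisfies Minkowski's integral inequality up to a constant, which reduces the claim to the single
  kernels \<open>norm (x - y) powr (\<alpha> - n) / v x\<close>. With \<open>\<gamma> = - \<beta> q > n\<close> this asks that the integral of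
  \<open>u x * norm x powr - \<gamma>\<close> over all \<open>x\<close> with \<open>s * norm (x - y) ^ n < norm x powr \<gamma>\<close> be at most \<open>C u(y) / s\<close>.
  Where \<open>norm x\<close> is comparable to \<open>norm y\<close>, the domain lies in one ball around \<open>y\<close>. Elsewhere
  \<open>norm (x - y)\<close> is at least half of \<open>max (norm x) (norm y)\<close>, which keeps \<open>x\<close> away from the origin, and the
  sum over dyadic balls around the origin is a geometric series. Both parts use \<open>A\<^sub>1\<close> only on balls that
  contain \<open>y\<close>.
\<close>

section \<open>Weak type bounds\<close>

lemma sum_geometric_ennreal:
  fixes c r :: real
  assumes "0 \<le> c" "0 \<le> r" "r < 1"
  shows "(\<Sum>k. ennreal (c * r ^ k)) = ennreal (c / (1 - r))"
proof -
  have "(\<lambda>k. c * r ^ k) sums (c * (1 / (1 - r)))"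
    using assms by (intro sums_mult geometric_sums) auto
  then show ?thesis
    using assms by (intro suminf_ennreal_eq) auto
qed

text \<open>The index is one less than the least \<open>n\<close> with
  \<open>x \<le> 2 ^ n * r\<close>; that \<open>n\<close> is nonzero because \<open>r < x\<close>.
  Both the values of a function and the distances to the origin are sorted into dyadic shells this
  way.\<close>

lemma dyadic_interval:
  fixes x r :: real
  assumes "0 < r" "r < x"
  obtains k :: nat where "2 ^ k * r < x" "x \<le> 2 ^ Suc k * r"
proof -
  obtain n where "x / r < 2 ^ n"
    using real_arch_pow[of 2 "x / r"] by auto
  then have ex: "x \<le> 2 ^ n * r"
    using assms by (simp add: field_simps)
  define n0 where "n0 = (LEAST n. x \<le> 2 ^ n * r)"
  have n0: "x \<le> 2 ^ n0 * r" unfolding n0_def by (rule LeastI[of _ n]) (rule ex)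
  have "n0 \<noteq> 0" using n0 assms by (intro notI) simp
  then obtain k where k: "n0 = Suc k" by (cases n0) auto
  have "\<not> x \<le> 2 ^ k * r"
    using not_less_Least[of k "\<lambda>n. x \<le> 2 ^ n * r"] k by (simp add: n0_def)
  then show ?thesis using that[of k] n0 k by simp
qed

text \<open>Kolmogorov's inequality: for \<open>q > 1\<close> a weak \<open>L^q\<close> function is
  integrable over sets of finite measure. Values up to a height \<open>l\<close> contribute at most
  \<open>l\<close> times the measure of \<open>E\<close>, and the dyadic levels above
  \<open>l\<close> give a geometric series of ratio \<open>2 powr (1 - q)\<close>.\<close>

lemma weak_type_nn_integral_le:
  fixes h :: "'a \<Rightarrow> real" and A q :: real
  assumes q: "1 < q" and A: "0 < A"
    and h[measurable]: "h \<in> borel_measurable M" and E[measurable]: "E \<in> sets M"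
    and fin: "emeasure M E < \<infinity>"
    and weak: "\<And>t. 0 < t \<Longrightarrow> emeasure M {x \<in> space M. t < h x} \<le> ennreal (A * t powr - q)"
  shows "(\<integral>\<^sup>+x\<in>E. ennreal (h x) \<partial>M) \<le>
    ennreal ((1 + 2 / (1 - 2 powr (1 - q))) * A powr (1 / q) * measure M E powr (1 - 1 / q))"
proof (cases "measure M E = 0")
  case True
  then have "emeasure M E = 0"
    using fin by (simp add: emeasure_eq_ennreal_measure)
  then have "(\<integral>\<^sup>+x\<in>E. ennreal (h x) \<partial>M) = 0"
    by (intro nn_integral_null_set) (auto simp: null_sets_def)
  then show ?thesis by simp
next
  case False
  define m where "m = measure M E"
  have m: "0 < m" using False by (simp add: m_def zero_less_measure_iff)
  have emE: "emeasure M E = ennreal m"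
    using fin by (simp add: emeasure_eq_ennreal_measure m_def)
  \<comment> \<open>At this height the weak bound \<open>A * l powr - q\<close> equals
    \<open>m\<close>, so both contributions become multiples of \<open>l * m\<close>.\<close>
  define l where "l = (A / m) powr (1 / q)"
  have l: "0 < l" using A m by (simp add: l_def)
  have lq: "l powr - q = m / A"
    using A m q by (simp add: l_def powr_powr powr_minus_divide)
  have lm: "l * m = A powr (1 / q) * m powr (1 - 1 / q)"
    using A m by (simp add: l_def powr_divide powr_diff)
  define r where "r = (2::real) powr (1 - q)"
  have r: "0 < r" "r < 1" using q by (auto simp: r_def powr_less_one)
  \<comment> \<open>Above height \<open>l\<close> a single dyadic index already dominates
    \<open>h x\<close>. The restriction to \<open>E\<close> is dropped there, since
    \<open>weak\<close> controls the whole superlevel set.\<close>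
  have pw: "ennreal (h x) * indicator E x \<le> ennreal l * indicator E x +
      (\<Sum>k. ennreal (2 ^ Suc k * l) * indicator {x \<in> space M. 2 ^ k * l < h x} x)"
    if x: "x \<in> space M" for x
  proof (cases "x \<in> E")
    case xE: True
    show ?thesis
    proof (cases "h x \<le> l")
      case True
      then have "ennreal (h x) * indicator E x \<le> ennreal l * indicator E x"
        by (intro mult_right_mono ennreal_leI) auto
      then show ?thesis by (rule order_trans) simp
    next
      case False
      then obtain k where k: "2 ^ k * l < h x" "h x \<le> 2 ^ Suc k * l"
        using dyadic_interval[of l "h x"] l by auto
      let ?f = "\<lambda>k. ennreal (2 ^ Suc k * l) * indicator {x \<in> space M. 2 ^ k * l < h x} x"
      have "ennreal (h x) * indicator E x \<le> sum ?f {k}"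
        using k x xE by (simp add: ennreal_leI del: power_Suc)
      also have "\<dots> \<le> (\<Sum>k. ?f k)"
        by (rule sum_le_suminf) auto
      finally show ?thesis by (rule order_trans) simp
    qed
  qed simp
  have "(\<integral>\<^sup>+x\<in>E. ennreal (h x) \<partial>M) \<le> (\<integral>\<^sup>+x. ennreal l * indicator E x +
      (\<Sum>k. ennreal (2 ^ Suc k * l) * indicator {x \<in> space M. 2 ^ k * l < h x} x) \<partial>M)"
    by (intro nn_integral_mono pw)
  also have "\<dots> = ennreal l * emeasure M E +
      (\<Sum>k. ennreal (2 ^ Suc k * l) * emeasure M {x \<in> space M. 2 ^ k * l < h x})"
    by (simp add: nn_integral_add nn_integral_suminf nn_integral_cmult_indicator)
  also have "\<dots> \<le> ennreal (l * m) + (\<Sum>k. ennreal (2 * l * m * r ^ k))"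
  proof (intro add_mono suminf_le summableI)
    show "ennreal l * emeasure M E \<le> ennreal (l * m)"
      using l m by (simp add: emE ennreal_mult)
    fix k :: nat
    have e: "2 ^ Suc k * l * (A * (2 ^ k * l) powr - q) = 2 * l * m * r ^ k"
    proof -
      have "(2 ^ k * l) powr - q = (2 powr - q) ^ k * (m / A)"
        using l by (simp add: powr_mult lq powr_power powr_realpow[symmetric] powr_powr mult.commute)
      moreover have "r = 2 * 2 powr - q" by (simp add: r_def powr_diff powr_minus_divide)
      ultimately show ?thesis using A by (simp add: power_mult_distrib)
    qed
    have "ennreal (2 ^ Suc k * l) * emeasure M {x \<in> space M. 2 ^ k * l < h x}
        \<le> ennreal (2 ^ Suc k * l) * ennreal (A * (2 ^ k * l) powr - q)"
      using l by (intro mult_left_mono weak) auto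
    also have "\<dots> = ennreal (2 * l * m * r ^ k)"
      unfolding e[symmetric] using l A by (intro ennreal_mult[symmetric]) auto
    finally show "ennreal (2 ^ Suc k * l) * emeasure M {x \<in> space M. 2 ^ k * l < h x}
        \<le> ennreal (2 * l * m * r ^ k)" .
  qed
  also have "\<dots> = ennreal (l * m + 2 * l * m / (1 - r))"
    using l m r by (subst sum_geometric_ennreal) (auto simp: ennreal_plus)
  also have "l * m + 2 * l * m / (1 - r) = (1 + 2 / (1 - r)) * (l * m)"
    by (simp add: algebra_simps add_divide_distrib)
  finally show ?thesis
    by (simp only: lm r_def[symmetric] m_def[symmetric] mult.assoc)
qed

section \<open>Muckenhoupt weights\<close>

text \<open>Fubini's theorem is applied below to products of completed Lebesgue measures, which
  requires sigma-finiteness of \<open>lebesgue\<close> itself.\<close>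

lemma sigma_finite_lebesgue: "sigma_finite_measure (lebesgue :: 'a::euclidean_space measure)"
proof
  show "\<exists>A. countable A \<and> A \<subseteq> sets (lebesgue :: 'a measure) \<and> \<Union>A = space (lebesgue :: 'a measure) \<and>
      (\<forall>a\<in>A. emeasure (lebesgue :: 'a measure) a \<noteq> \<infinity>)"
  proof (intro exI[of _ "range (\<lambda>n::nat. ball (0::'a) (real n))"] conjI ballI)
    show "\<Union>(range (\<lambda>n::nat. ball (0::'a) (real n))) = space lebesgue"
      using reals_Archimedean2 by auto
    fix a assume "a \<in> range (\<lambda>n::nat. ball (0::'a) (real n))"
    then show "emeasure lebesgue a \<noteq> \<infinity>"
      using emeasure_lborel_ball_finite[where ?'a='a] by (auto simp: less_top)
  qed auto
qed

text \<open>Local integrability only speaks about compact sets; the cut-offs to growing closed balls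
  are measurable and eventually constant at each point.\<close>

lemma locally_integrable_measurable:
  assumes "locally_integrable (f :: real ^ 'n \<Rightarrow> 'b::{banach, second_countable_topology})"
  shows "f \<in> borel_measurable lebesgue"
proof -
  have *: "(\<lambda>x. indicat_real (cball 0 (real n)) x *\<^sub>R f x) \<in> borel_measurable lebesgue" for n :: nat
    using assms by (intro borel_measurable_integrable) (simp add: locally_integrable_def set_integrable_def)
  show ?thesis
  proof (rule borel_measurable_LIMSEQ_metric[OF *])
    fix x :: "real ^ 'n"
    obtain N :: nat where "norm x < real N" using reals_Archimedean2 by blast
    then have "\<forall>\<^sub>F n in sequentially. indicat_real (cball 0 (real n)) x *\<^sub>R f x = f x"
      by (intro eventually_sequentiallyI[of N]) (auto simp: indicator_def)
    then show "(\<lambda>n. indicat_real (cball 0 (real n)) x *\<^sub>R f x) \<longlonglongrightarrow> f x"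
      by (rule tendsto_eventually)
  qed
qed

text \<open>The essential infimum over \<open>Q\<close> is at most \<open>u y\<close> for almost
  every \<open>y\<close> in \<open>Q\<close>. The exceptional null set still depends on
  \<open>Q\<close>.\<close>

lemma A1_weight_cube:
  fixes u :: "real ^ 'n \<Rightarrow> real"
  assumes w: "weight u" and C: "0 < C" and l: "0 < l"
    and Q: "Q = cbox a (\<chi> i. a $ i + l)"
    and le: "ereal ((LINT x:Q|lebesgue. u x) / measure lebesgue Q) \<le> ereal C * ess_inf_on Q u"
  shows "AE y in lebesgue. y \<in> Q \<longrightarrow> (\<integral>\<^sup>+x\<in>Q. ennreal (u x) \<partial>lebesgue) \<le> ennreal (C * l ^ CARD('n) * u y)"
proof -
  have intQ: "set_integrable lebesgue Q u"
    using w by (auto simp: weight_def locally_integrable_def Q)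
  have pos: "AE x in lebesgue. 0 < u x" using w by (simp add: weight_def)
  have "(\<integral>\<^sup>+x\<in>Q. ennreal (u x) \<partial>lebesgue) = (\<integral>\<^sup>+x. ennreal (indicat_real Q x *\<^sub>R u x) \<partial>lebesgue)"
    by (intro nn_integral_cong) (auto simp: indicator_def)
  also have "\<dots> = ennreal (LINT x:Q|lebesgue. u x)"
    unfolding set_lebesgue_integral_def
    by (rule nn_integral_eq_integral) (use intQ pos in \<open>auto simp: set_integrable_def\<close>)
  finally have nn: "(\<integral>\<^sup>+x\<in>Q. ennreal (u x) \<partial>lebesgue) = ennreal (LINT x:Q|lebesgue. u x)" .
  have mQ: "measure lebesgue Q = l ^ CARD('n)"
    using l content_cbox_cart[of a "\<chi> i. a $ i + l"] unfolding Q by (simp add: interval_ne_empty_cart)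
  have "AE x in lebesgue_on Q. - ereal (u x) \<le> esssup (lebesgue_on Q) (\<lambda>x. - ereal (u x))"
    by (rule esssup_AE)
  then have "AE x in lebesgue. x \<in> Q \<longrightarrow> - ereal (u x) \<le> esssup (lebesgue_on Q) (\<lambda>x. - ereal (u x))"
    by (subst (asm) AE_restrict_space_iff) (auto simp: Q)
  then show ?thesis
  proof eventually_elim
    case (elim y)
    show ?case
    proof
      assume "y \<in> Q"
      with elim have "ess_inf_on Q u \<le> ereal (u y)"
        by (simp add: ess_inf_on_def ereal_uminus_le_reorder)
      then have "ereal C * ess_inf_on Q u \<le> ereal C * ereal (u y)"
        using C by (intro ereal_mult_left_mono) auto
      with le have "ereal ((LINT x:Q|lebesgue. u x) / measure lebesgue Q) \<le> ereal (C * u y)"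
        by (metis order_trans times_ereal.simps(1))
      then have "(LINT x:Q|lebesgue. u x) \<le> C * l ^ CARD('n) * u y"
        using l by (simp add: mQ field_simps)
      then show "(\<integral>\<^sup>+x\<in>Q. ennreal (u x) \<partial>lebesgue) \<le> ennreal (C * l ^ CARD('n) * u y)"
        by (simp add: nn ennreal_leI)
    qed
  qed
qed

text \<open>One null set must serve all balls. Only countably many cubes are used, with lower corner
  in a countable dense set and rational side; every ball of radius \<open>R\<close> lies in such a
  cube of side less than \<open>4 * R\<close>, which costs the factor
  \<open>4 ^ CARD('n)\<close>.\<close>

lemma A1_weight_cball:
  fixes u :: "real ^ 'n \<Rightarrow> real"
  assumes "A1_weight u"
  obtains C where "0 < C"
    and "AE y in lebesgue. \<forall>z R. 0 < R \<longrightarrow> norm (z - y) \<le> R \<longrightarrow>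
      (\<integral>\<^sup>+x\<in>cball z R. ennreal (u x) \<partial>lebesgue) \<le> ennreal (C * R ^ CARD('n) * u y)"
proof -
  obtain C where w: "weight u" and C: "0 < C"
    and le: "\<And>Q. cube Q \<Longrightarrow> ereal ((LINT x:Q|lebesgue. u x) / measure lebesgue Q) \<le> ereal C * ess_inf_on Q u"
    using assms unfolding A1_weight_def by blast
  define Q where "Q = (\<lambda>(a :: real ^ 'n, l). cbox a (\<chi> i. a $ i + l))"
  obtain D :: "(real ^ 'n) set" where D: "countable D" "\<And>X. open X \<Longrightarrow> X \<noteq> {} \<Longrightarrow> \<exists>d\<in>D. d \<in> X"
    using countable_dense_setE by blast
  have "AE y in lebesgue. \<forall>al\<in>D \<times> {l\<in>\<rat>. 0 < l}. y \<in> Q al \<longrightarrow>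
      (\<integral>\<^sup>+x\<in>Q al. ennreal (u x) \<partial>lebesgue) \<le> ennreal (C * snd al ^ CARD('n) * u y)"
  proof (intro AE_ball_countable[THEN iffD2] ballI countable_SIGMA D(1))
    show "countable {l::real. l \<in> \<rat> \<and> 0 < l}"
      by (rule countable_subset[OF _ countable_rat]) auto
    fix al :: "(real ^ 'n) \<times> real" assume al: "al \<in> D \<times> {l\<in>\<rat>. 0 < l}"
    then have "cube (Q al)" by (auto simp: cube_def Q_def)
    with al show "AE y in lebesgue. y \<in> Q al \<longrightarrow>
        (\<integral>\<^sup>+x\<in>Q al. ennreal (u x) \<partial>lebesgue) \<le> ennreal (C * snd al ^ CARD('n) * u y)"
      by (intro A1_weight_cube[OF w C _ _ le, where a="fst al"]) (auto simp: Q_def split_beta)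
  qed
  moreover have "AE x in lebesgue. 0 < u x" using w by (simp add: weight_def)
  ultimately have "AE y in lebesgue. \<forall>z R. 0 < R \<longrightarrow> norm (z - y) \<le> R \<longrightarrow>
      (\<integral>\<^sup>+x\<in>cball z R. ennreal (u x) \<partial>lebesgue) \<le> ennreal (C * 4 ^ CARD('n) * R ^ CARD('n) * u y)"
  proof eventually_elim
    case (elim y)
    show ?case
    proof (intro allI impI)
      fix z :: "real ^ 'n" and R :: real
      assume R: "0 < R" and zy: "norm (z - y) \<le> R"
      \<comment> \<open>A lower corner in this box lies below the ball by at least \<open>R\<close>
        and at most \<open>2 * R\<close> around the centre in each coordinate, so any side above
        \<open>3 * R\<close> makes the cube reach past the ball.\<close>
      define X where "X = box (\<chi> i. z $ i - 2 * R) (\<chi> i. z $ i - R)"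
      have "open X" "X \<noteq> {}" using R by (auto simp: X_def interval_ne_empty_cart)
      then obtain a where a: "a \<in> D" "a \<in> X" using D(2) by blast
      obtain l where l: "l \<in> \<rat>" "3 * R < l" "l < 4 * R"
        using Rats_dense_in_real[of "3 * R" "4 * R"] R by auto
      have sub: "cball z R \<subseteq> Q (a, l)"
      proof
        fix x assume "x \<in> cball z R"
        then have "\<bar>(z - x) $ i\<bar> \<le> R" for i
          using component_le_norm_cart[of "z - x" i] by (simp add: dist_norm)
        moreover have "z $ i - 2 * R < a $ i" "a $ i < z $ i - R" for i
          using a by (auto simp: X_def mem_box_cart)
        ultimately show "x \<in> Q (a, l)"
          using l unfolding Q_def by (auto simp: mem_box_cart abs_le_iff) (smt (verit))+
      qed
      have "y \<in> Q (a, l)" using sub zy by (auto simp: dist_norm)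
      have "(\<integral>\<^sup>+x\<in>cball z R. ennreal (u x) \<partial>lebesgue) \<le> (\<integral>\<^sup>+x\<in>Q (a, l). ennreal (u x) \<partial>lebesgue)"
        using sub by (intro nn_integral_mono mult_left_mono) (auto simp: indicator_def)
      also have "\<dots> \<le> ennreal (C * l ^ CARD('n) * u y)"
        using elim(1) a l R \<open>y \<in> Q (a, l)\<close> by fastforce
      also have "\<dots> \<le> ennreal (C * (4 * R) ^ CARD('n) * u y)"
        using l R C elim(2) by (intro ennreal_leI mult_mono power_mono) auto
      finally show "(\<integral>\<^sup>+x\<in>cball z R. ennreal (u x) \<partial>lebesgue)
          \<le> ennreal (C * 4 ^ CARD('n) * R ^ CARD('n) * u y)"
        by (simp add: power_mult_distrib mult.assoc)
    qed
  qed
  then show ?thesis using that[of "C * 4 ^ CARD('n)"] C by simp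
qed

section \<open>Integrating an \<open>A_1\<close> weight against a single kernel\<close>

text \<open>Since \<open>\<gamma> > n\<close>, the quotient of \<open>r powr \<gamma>\<close> by
  \<open>max r w ^ n\<close> increases in \<open>r\<close>, so the condition on \<open>r\<close>
  holds only beyond a threshold. With \<open>w\<close> the norm of \<open>y\<close> this keeps
  \<open>x\<close> away from the origin, and the second conclusion turns the threshold into the
  decay \<open>1 / S\<close>.\<close>

lemma powr_growth_threshold:
  fixes S \<gamma> w :: real and n :: nat
  assumes S: "0 < S" and g: "real n < \<gamma>" and w: "0 < w"
  obtains \<rho> where "0 < \<rho>" and "max \<rho> w ^ n * \<rho> powr - \<gamma> \<le> 1 / S"
    and "\<And>r. 0 < r \<Longrightarrow> S * max r w ^ n < r powr \<gamma> \<Longrightarrow> \<rho> < r"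
proof -
  define a where "a = (S * w ^ n) powr (1 / \<gamma>)"
  define b where "b = S powr (1 / (\<gamma> - n))"
  have gpos: "0 < \<gamma>" using g by linarith
  have a: "0 < a" "a powr \<gamma> = S * w ^ n" using S w gpos by (auto simp: a_def powr_powr)
  have b: "0 < b" "b powr (\<gamma> - n) = S" using S g by (auto simp: b_def powr_powr)
  \<comment> \<open>The numbers \<open>a\<close> and \<open>b\<close> solve the threshold equation
    with the maximum replaced by \<open>w\<close> and by \<open>r\<close> respectively; the larger
    one handles both cases.\<close>
  define \<rho> where "\<rho> = max a b"
  have \<rho>: "0 < \<rho>" using a by (simp add: \<rho>_def less_max_iff_disj)
  have 1: "S * w ^ n \<le> \<rho> powr \<gamma>"
    unfolding a(2)[symmetric] using a gpos by (intro powr_mono2) (auto simp: \<rho>_def)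
  have "S \<le> \<rho> powr (\<gamma> - n)"
    unfolding b(2)[symmetric] using b g by (intro powr_mono2) (auto simp: \<rho>_def)
  then have 2: "S * \<rho> ^ n \<le> \<rho> powr \<gamma>"
    using \<rho> by (simp add: powr_diff powr_realpow field_simps)
  have "S * max \<rho> w ^ n \<le> \<rho> powr \<gamma>"
    using 1 2 by (cases "\<rho> \<le> w") (auto simp: max_def)
  then have 3: "max \<rho> w ^ n * \<rho> powr - \<gamma> \<le> 1 / S"
    using S \<rho> by (simp add: powr_minus_divide field_simps)
  have "\<rho> < r" if r: "0 < r" and less: "S * max r w ^ n < r powr \<gamma>" for r
  proof -
    have "S * w ^ n \<le> S * max r w ^ n" "S * r ^ n \<le> S * max r w ^ n"
      using S w r by (auto intro!: mult_left_mono power_mono)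
    then have l: "S * w ^ n < r powr \<gamma>" "S * r ^ n < r powr \<gamma>" using less by auto
    have "a < r"
      using l(1) a gpos r by (metis not_le powr_mono2 less_imp_le)
    moreover have "b < r"
    proof (rule ccontr)
      assume "\<not> b < r"
      then have "r powr (\<gamma> - n) \<le> S"
        unfolding b(2)[symmetric] using r g by (intro powr_mono2) auto
      then show False
        using l(2) r by (simp add: powr_diff powr_realpow field_simps)
    qed
    ultimately show ?thesis by (simp add: \<rho>_def)
  qed
  with \<rho> 3 show ?thesis using that by blast
qed

text \<open>The number \<open>a\<close> stands for \<open>u y\<close> at a point \<open>y\<close>
  where the \<open>A_1\<close> bound holds for all balls containing \<open>y\<close>. The summand
  \<open>4 powr \<gamma>\<close> comes from the \<open>x\<close> with norm comparable to that of
  \<open>y\<close>, the other one from the remaining \<open>x\<close>.\<close>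

lemma A1_kernel_bound:
  fixes u :: "real ^ 'n \<Rightarrow> real" and y :: "real ^ 'n" and a C \<gamma> s :: real
  defines "n \<equiv> CARD('n)"
  assumes u[measurable]: "u \<in> borel_measurable lebesgue"
    and y: "y \<noteq> 0" and a: "0 \<le> a" and C: "0 \<le> C"
    and ball: "\<And>z R. 0 < R \<Longrightarrow> norm (z - y) \<le> R \<Longrightarrow>
      (\<integral>\<^sup>+x\<in>cball z R. ennreal (u x) \<partial>lebesgue) \<le> ennreal (C * R ^ n * a)"
    and \<gamma>: "real n < \<gamma>" and s: "0 < s"
  shows "(\<integral>\<^sup>+x\<in>{x. x \<noteq> 0 \<and> s * norm (x - y) ^ n < norm x powr \<gamma>}.
      ennreal (u x * norm x powr - \<gamma>) \<partial>lebesgue)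
    \<le> ennreal (C * (4 powr \<gamma> + 4 ^ n / (1 - 2 powr (n - \<gamma>))) * a / s)"
proof -
  have n: "0 < n" by (simp add: n_def)
  have gpos: "0 < \<gamma>" using \<gamma> by linarith
  have ny: "0 < norm y" using y by simp
  \<comment> \<open>The factor \<open>2 ^ n\<close> pays for replacing \<open>norm (x - y)\<close>
    by half of \<open>max (norm x) (norm y)\<close> in the far region.\<close>
  define S where "S = s / 2 ^ n"
  have S: "0 < S" using s by (simp add: S_def)
  obtain \<rho> where \<rho>: "0 < \<rho>" and \<rho>S: "max \<rho> (norm y) ^ n * \<rho> powr - \<gamma> \<le> 1 / S"
    and far: "\<And>r. 0 < r \<Longrightarrow> S * max r (norm y) ^ n < r powr \<gamma> \<Longrightarrow> \<rho> < r"
    by (rule powr_growth_threshold[OF S \<gamma> ny]) blast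
  \<comment> \<open>If \<open>norm x \<le> 2 * norm y\<close>, the condition on \<open>x\<close>
    gives \<open>norm (x - y) ^ n \<le> R0 ^ n\<close>, so the near region lies in one ball around
    \<open>y\<close>.\<close>
  define R0 where "R0 = ((2 * norm y) powr \<gamma> / s) powr (1 / n)"
  have R0: "0 < R0" "R0 ^ n = (2 * norm y) powr \<gamma> / s"
    using y s n by (auto simp: R0_def powr_powr powr_realpow[symmetric])
  \<comment> \<open>The maximum with \<open>norm y\<close> puts \<open>y\<close> into the ball
    around the origin, as hypothesis \<open>ball\<close> demands, even when the dyadic radius is
    smaller.\<close>
  define R where "R k = max (2 ^ Suc k * \<rho>) (norm y)" for k
  define c0 where "c0 = (norm y / 2) powr - \<gamma>"
  define c where "c k = (2 ^ k * \<rho>) powr - \<gamma>" for k :: nat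
  define r where "r = (2::real) powr (n - \<gamma>)"
  have r: "0 < r" "r < 1" using \<gamma> by (auto simp: r_def powr_less_one)
  define E where "E = {x. x \<noteq> 0 \<and> s * norm (x - y) ^ n < norm x powr \<gamma>}"
  let ?f = "\<lambda>k x. ennreal (c k) * (ennreal (u x) * indicator (cball 0 (R k)) x)"
  let ?g = "\<lambda>x. ennreal c0 * (ennreal (u x) * indicator (cball y R0) x)"
  have e: "ennreal (u x * norm x powr - \<gamma>) = ennreal (norm x powr - \<gamma>) * ennreal (u x)" for x
    by (simp add: ennreal_mult'' mult.commute)
  have pw: "ennreal (u x * norm x powr - \<gamma>) * indicator E x \<le> ?g x + (\<Sum>k. ?f k x)" for x
  proof (cases "x \<in> E")
    case True
    then have x: "0 < norm x" and sx: "s * norm (x - y) ^ n < norm x powr \<gamma>"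
      by (auto simp: E_def)
    show ?thesis
    proof (cases "norm y / 2 \<le> norm x \<and> norm x \<le> 2 * norm y")
      case near: True
      have "s * norm (x - y) ^ n \<le> (2 * norm y) powr \<gamma>"
        using sx near gpos by (intro order_trans[OF less_imp_le powr_mono2]) auto
      then have "norm (x - y) ^ n \<le> R0 ^ n"
        using s by (simp add: R0 field_simps)
      then have "norm (x - y) \<le> R0"
        using R0 n by (metis power_mono_iff norm_ge_zero less_imp_le)
      then have "x \<in> cball y R0" by (simp add: dist_norm norm_minus_commute)
      moreover have "norm x powr - \<gamma> \<le> c0"
        unfolding c0_def using near ny gpos by (intro powr_mono2') auto
      ultimately have "ennreal (u x * norm x powr - \<gamma>) * indicator E x \<le> ?g x"
        using True by (simp add: e mult_right_mono ennreal_leI)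
      then show ?thesis by (rule order_trans) simp
    next
      case False
      have "max (norm x) (norm y) \<le> 2 * norm (x - y)"
        using False norm_triangle_ineq2[of x y] norm_triangle_ineq2[of y x]
        by (auto simp: norm_minus_commute max_def)
      then have "max (norm x) (norm y) ^ n \<le> 2 ^ n * norm (x - y) ^ n"
        unfolding power_mult_distrib[symmetric] by (intro power_mono) (auto simp: le_max_iff_disj)
      then have "S * max (norm x) (norm y) ^ n \<le> s * norm (x - y) ^ n"
        using s by (simp add: S_def field_simps)
      then have "\<rho> < norm x" using far[OF x] sx by linarith
      then obtain k where k: "2 ^ k * \<rho> < norm x" "norm x \<le> 2 ^ Suc k * \<rho>"
        using dyadic_interval[OF \<rho>] by blast
      have "norm x powr - \<gamma> \<le> c k"
        unfolding c_def using k \<rho> gpos by (intro powr_mono2') auto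
      moreover have "x \<in> cball 0 (R k)" using k by (simp add: R_def)
      ultimately have "ennreal (u x * norm x powr - \<gamma>) * indicator E x \<le> sum (\<lambda>k. ?f k x) {k}"
        using True by (simp add: e mult_right_mono ennreal_leI)
      also have "\<dots> \<le> (\<Sum>k. ?f k x)" by (rule sum_le_suminf) auto
      finally show ?thesis by (rule order_trans) simp
    qed
  qed simp
  have cb[measurable]: "cball z t \<in> sets lebesgue" for z :: "real ^ 'n" and t by simp
  have "(\<lambda>x. ennreal (u x) * indicator (cball z t) x) \<in> borel_measurable lebesgue" for z t
    by measurable
  note [simp] = this
  have "(\<integral>\<^sup>+x\<in>E. ennreal (u x * norm x powr - \<gamma>) \<partial>lebesgue) \<le> (\<integral>\<^sup>+x. ?g x + (\<Sum>k. ?f k x) \<partial>lebesgue)"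
    by (intro nn_integral_mono pw)
  also have "\<dots> = ennreal c0 * (\<integral>\<^sup>+x\<in>cball y R0. ennreal (u x) \<partial>lebesgue) +
      (\<Sum>k. ennreal (c k) * (\<integral>\<^sup>+x\<in>cball 0 (R k). ennreal (u x) \<partial>lebesgue))"
    by (simp add: nn_integral_add nn_integral_suminf nn_integral_cmult)
  also have "\<dots> \<le> ennreal (C * 4 powr \<gamma> * a / s) + (\<Sum>k. ennreal (C * 4 ^ n * a / s * r ^ k))"
  proof (intro add_mono suminf_le summableI)
    have "ennreal c0 * (\<integral>\<^sup>+x\<in>cball y R0. ennreal (u x) \<partial>lebesgue) \<le> ennreal c0 * ennreal (C * R0 ^ n * a)"
      using R0 by (intro mult_left_mono ball) auto
    also have "\<dots> = ennreal (c0 * (C * R0 ^ n * a))"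
      by (simp add: c0_def ennreal_mult')
    also have "c0 * (C * R0 ^ n * a) = C * 4 powr \<gamma> * a / s"
    proof -
      have "4 powr \<gamma> = 2 powr \<gamma> * 2 powr \<gamma>" by (simp add: powr_mult[symmetric])
      then show ?thesis
        using ny by (simp add: c0_def R0 powr_minus_divide powr_divide powr_mult)
    qed
    finally show "ennreal c0 * (\<integral>\<^sup>+x\<in>cball y R0. ennreal (u x) \<partial>lebesgue) \<le> ennreal (C * 4 powr \<gamma> * a / s)" .
    fix k :: nat
    \<comment> \<open>Bounding the radius by a power of two times a quantity free of
      \<open>k\<close> exposes the ratio \<open>r\<close>: the growth \<open>2 ^ n\<close> of the
      volume per step is beaten by the decay \<open>2 powr - \<gamma>\<close> of the kernel.\<close>
    have "R k \<le> 2 ^ Suc k * max \<rho> (norm y)"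
    proof -
      have "1 * norm y \<le> 2 ^ Suc k * max \<rho> (norm y)"
        using ny by (intro mult_mono) (auto simp del: power_Suc)
      moreover have "2 ^ Suc k * \<rho> \<le> 2 ^ Suc k * max \<rho> (norm y)"
        by (intro mult_left_mono) auto
      ultimately show ?thesis by (simp add: R_def del: power_Suc)
    qed
    then have Rk: "R k ^ n \<le> (2 ^ Suc k * max \<rho> (norm y)) ^ n"
      by (intro power_mono) (auto simp: R_def le_max_iff_disj)
    have "c k * R k ^ n \<le> c k * (2 ^ Suc k * max \<rho> (norm y)) ^ n"
      using Rk by (intro mult_left_mono) (auto simp: c_def)
    also have "\<dots> = 2 ^ n * r ^ k * (max \<rho> (norm y) ^ n * \<rho> powr - \<gamma>)"
    proof -
      have "c k = (2 powr - \<gamma>) ^ k * \<rho> powr - \<gamma>"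
        using \<rho> by (simp add: c_def powr_mult powr_power powr_realpow[symmetric] powr_powr mult.commute)
      moreover have "r = 2 ^ n * 2 powr - \<gamma>"
        by (simp add: r_def powr_diff powr_minus_divide powr_realpow)
      ultimately show ?thesis
        by (simp add: power_mult_distrib power_mult[symmetric] mult.commute mult.left_commute)
    qed
    also have "\<dots> \<le> 2 ^ n * r ^ k * (1 / S)"
      using \<rho>S r by (intro mult_left_mono) auto
    also have "\<dots> = 4 ^ n * r ^ k / s"
      by (simp add: S_def power_mult_distrib[symmetric])
    finally have ck: "c k * R k ^ n \<le> 4 ^ n * r ^ k / s" .
    have "ennreal (c k) * (\<integral>\<^sup>+x\<in>cball 0 (R k). ennreal (u x) \<partial>lebesgue) \<le> ennreal (c k) * ennreal (C * R k ^ n * a)"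
      using \<rho> by (intro mult_left_mono ball) (auto simp: R_def less_max_iff_disj)
    also have "\<dots> = ennreal (c k * (C * R k ^ n * a))"
      by (simp add: c_def ennreal_mult')
    also have "\<dots> \<le> ennreal (C * 4 ^ n * a / s * r ^ k)"
    proof (rule ennreal_leI)
      have "C * a * (c k * R k ^ n) \<le> C * a * (4 ^ n * r ^ k / s)"
        using ck C a by (intro mult_left_mono) auto
      then show "c k * (C * R k ^ n * a) \<le> C * 4 ^ n * a / s * r ^ k"
        by (simp add: mult_ac)
    qed
    finally show "ennreal (c k) * (\<integral>\<^sup>+x\<in>cball 0 (R k). ennreal (u x) \<partial>lebesgue)
        \<le> ennreal (C * 4 ^ n * a / s * r ^ k)" .
  qed
  also have "\<dots> = ennreal (C * 4 powr \<gamma> * a / s + C * 4 ^ n * a / s / (1 - r))"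
    using C a s r by (subst sum_geometric_ennreal) (auto simp: ennreal_plus)
  also have "C * 4 powr \<gamma> * a / s + C * 4 ^ n * a / s / (1 - r)
      = C * (4 powr \<gamma> + 4 ^ n / (1 - r)) * a / s"
    by (simp add: distrib_left distrib_right add_divide_distrib mult_ac)
  finally show ?thesis
    by (simp only: E_def r_def)
qed

section \<open>The weighted weak type inequality for fractional integrals\<close>

lemma two_powr_less_one:
  fixes c :: real
  assumes "c < 0"
  shows "2 powr c < 1"
  using assms powr_less_mono[of c 0 2] by simp

lemma weak_type_const_pos:
  fixes q :: real
  assumes "1 < q"
  shows "0 < 1 + 2 / (1 - 2 powr (1 - q))"
  using two_powr_less_one[of "1 - q"] assms by (intro add_pos_nonneg) auto

section \<open>Minkowski's integral inequality for weak \<open>L^q\<close>\<close>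

context
  fixes M :: "'a measure" and N :: "'b measure" and w :: "'a \<Rightarrow> ennreal" and h :: "'a \<Rightarrow> 'b \<Rightarrow> real"
    and g :: "'b \<Rightarrow> ennreal" and a :: "'b \<Rightarrow> real" and q t :: real
  assumes M: "sigma_finite_measure M" and N: "sigma_finite_measure N"
    and w[measurable]: "w \<in> borel_measurable M"
    and h[measurable]: "case_prod h \<in> borel_measurable (M \<Otimes>\<^sub>M N)"
    and g[measurable]: "g \<in> borel_measurable N"
    and a[measurable]: "a \<in> borel_measurable N"
    and q: "1 < q" and t: "0 < t"
    and weak: "AE y in N. 0 < a y \<and> (\<forall>s>0. emeasure (density M w) {x \<in> space M. s < h x y} \<le> ennreal (a y * s powr - q))"
begin

text \<open>Integrating \<open>le\<close> over \<open>E\<close>, exchanging the integrals and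
  applying Kolmogorov's inequality to each \<open>h x y\<close> in \<open>x\<close> bounds
  \<open>t\<close> times the measure of \<open>E\<close> by its power \<open>1 - 1 / q\<close> times
  the integral on the right. Dividing by that power is legitimate because the measure is
  finite.\<close>

lemma weak_type_integral_set:
  assumes E[measurable]: "E \<in> sets M" and fin: "emeasure (density M w) E < \<infinity>"
    and le: "\<And>x. x \<in> E \<Longrightarrow> ennreal t \<le> (\<integral>\<^sup>+y. ennreal (h x y) * g y \<partial>N)"
  shows "ennreal (measure (density M w) E powr (1 / q))
    \<le> ennreal ((1 + 2 / (1 - 2 powr (1 - q))) / t) * (\<integral>\<^sup>+y. ennreal (a y powr (1 / q)) * g y \<partial>N)"
proof -
  interpret M: sigma_finite_measure M by (rule M)
  interpret N: sigma_finite_measure N by (rule N)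
  interpret MN: pair_sigma_finite M N ..
  define K where "K = 1 + 2 / (1 - 2 powr (1 - q))"
  define m where "m = measure (density M w) E"
  define I where "I = (\<integral>\<^sup>+y. ennreal (a y powr (1 / q)) * g y \<partial>N)"
  have K: "0 < K" using weak_type_const_pos[OF q] by (simp add: K_def)
  have m0: "0 \<le> m" by (simp add: m_def)
  have em: "emeasure (density M w) E = ennreal m"
    using fin by (simp add: m_def emeasure_eq_ennreal_measure)
  have "ennreal t * ennreal m = (\<integral>\<^sup>+x. ennreal t * indicator E x \<partial>density M w)"
    by (simp add: em[symmetric] nn_integral_cmult_indicator)
  \<comment> \<open>The density becomes a factor of the integrand: Fubini is applied to
    \<open>M\<close>, since \<open>density M w\<close> is not assumed to be sigma-finite.\<close>
  also have "\<dots> = (\<integral>\<^sup>+x. w x * (ennreal t * indicator E x) \<partial>M)"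
    by (simp add: nn_integral_density)
  also have "\<dots> \<le> (\<integral>\<^sup>+x. w x * ((\<integral>\<^sup>+y. ennreal (h x y) * g y \<partial>N) * indicator E x) \<partial>M)"
    using le by (intro nn_integral_mono mult_left_mono) (auto simp: indicator_def)
  also have "\<dots> = (\<integral>\<^sup>+x. (\<integral>\<^sup>+y. w x * (ennreal (h x y) * g y * indicator E x) \<partial>N) \<partial>M)"
  proof (rule nn_integral_cong)
    fix x assume [measurable]: "x \<in> space M"
    show "w x * ((\<integral>\<^sup>+y. ennreal (h x y) * g y \<partial>N) * indicator E x)
        = (\<integral>\<^sup>+y. w x * (ennreal (h x y) * g y * indicator E x) \<partial>N)"
      by (simp add: nn_integral_cmult nn_integral_multc)
  qed
  also have "\<dots> = (\<integral>\<^sup>+y. (\<integral>\<^sup>+x. w x * (ennreal (h x y) * g y * indicator E x) \<partial>M) \<partial>N)"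
    by (rule MN.Fubini'[symmetric]) measurable
  also have "\<dots> = (\<integral>\<^sup>+y. g y * (\<integral>\<^sup>+x\<in>E. ennreal (h x y) \<partial>density M w) \<partial>N)"
  proof (rule nn_integral_cong)
    fix y assume [measurable]: "y \<in> space N"
    have "(\<integral>\<^sup>+x. w x * (ennreal (h x y) * g y * indicator E x) \<partial>M)
        = (\<integral>\<^sup>+x. g y * (w x * (ennreal (h x y) * indicator E x)) \<partial>M)"
      by (intro nn_integral_cong) (simp add: mult_ac)
    then show "(\<integral>\<^sup>+x. w x * (ennreal (h x y) * g y * indicator E x) \<partial>M)
        = g y * (\<integral>\<^sup>+x\<in>E. ennreal (h x y) \<partial>density M w)"
      by (simp add: nn_integral_cmult nn_integral_density)
  qed
  also have "\<dots> \<le> (\<integral>\<^sup>+y. ennreal (K * m powr (1 - 1 / q)) * (ennreal (a y powr (1 / q)) * g y) \<partial>N)"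
  proof (rule nn_integral_mono_AE)
    show "AE y in N. g y * (\<integral>\<^sup>+x\<in>E. ennreal (h x y) \<partial>density M w)
        \<le> ennreal (K * m powr (1 - 1 / q)) * (ennreal (a y powr (1 / q)) * g y)"
      using weak AE_space
    proof eventually_elim
      case (elim y)
      then have [measurable]: "y \<in> space N" by simp
      have "(\<integral>\<^sup>+x\<in>E. ennreal (h x y) \<partial>density M w) \<le> ennreal (K * a y powr (1 / q) * m powr (1 - 1 / q))"
        unfolding K_def m_def using elim fin q
        by (intro weak_type_nn_integral_le) auto
      also have "\<dots> = ennreal (K * m powr (1 - 1 / q)) * ennreal (a y powr (1 / q))"
        using K by (subst ennreal_mult[symmetric]) (auto simp: mult_ac)
      finally show ?case
        using mult_left_mono[of _ _ "g y"] by (fastforce simp: mult_ac)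
    qed
  qed
  also have "\<dots> = ennreal (K * m powr (1 - 1 / q)) * I"
    by (simp add: I_def nn_integral_cmult)
  finally have main: "ennreal t * ennreal m \<le> ennreal (K * m powr (1 - 1 / q)) * I" .
  have "ennreal (m powr (1 / q)) \<le> ennreal (K / t) * I"
  proof (cases "m = 0")
    case False
    with m0 have m: "0 < m" by simp
    \<comment> \<open>Multiplying by \<open>c\<close> turns \<open>t * m\<close> into
      \<open>m powr (1 / q)\<close> and cancels the power \<open>1 - 1 / q\<close> of
      \<open>m\<close> on the other side.\<close>
    define c where "c = m powr (1 / q - 1) / t"
    have c: "0 \<le> c" using t by (simp add: c_def)
    have "ennreal (m powr (1 / q)) = ennreal c * (ennreal t * ennreal m)"
      using m t by (simp add: c_def ennreal_mult[symmetric] powr_diff)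
    also have "\<dots> \<le> ennreal c * (ennreal (K * m powr (1 - 1 / q)) * I)"
      by (intro mult_left_mono main) simp
    also have "\<dots> = ennreal (c * (K * m powr (1 - 1 / q))) * I"
      using c K by (simp add: ennreal_mult mult_ac)
    also have "c * (K * m powr (1 - 1 / q)) = K / t"
      using m by (simp add: c_def powr_add[symmetric])
    finally show ?thesis .
  qed simp
  then show ?thesis by (simp add: K_def m_def I_def)
qed

text \<open>The set \<open>A\<close> may have infinite measure a priori, so the previous bound is
  applied to the pieces \<open>A \<inter> B k\<close>. It does not depend on \<open>k\<close> and
  passes to the supremum by continuity from below.\<close>

lemma weak_type_integral:
  fixes B :: "nat \<Rightarrow> 'a set"
  assumes A: "A \<in> sets M"
    and le: "\<And>x. x \<in> A \<Longrightarrow> ennreal t \<le> (\<integral>\<^sup>+y. ennreal (h x y) * g y \<partial>N)"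
    and B: "\<And>k. B k \<in> sets M" "incseq B" "A \<subseteq> (\<Union>k. B k)"
    and fin: "\<And>k. emeasure (density M w) (B k) < \<infinity>"
  shows "ennreal_powr (emeasure (density M w) A) (1 / q)
    \<le> ennreal ((1 + 2 / (1 - 2 powr (1 - q))) / t) * (\<integral>\<^sup>+y. ennreal (a y powr (1 / q)) * g y \<partial>N)"
proof -
  define K where "K = (1 + 2 / (1 - 2 powr (1 - q))) / t"
  have K: "0 < K" using weak_type_const_pos[OF q] t by (simp add: K_def)
  define I where "I = (\<integral>\<^sup>+y. ennreal (a y powr (1 / q)) * g y \<partial>N)"
  have "ennreal_powr (emeasure (density M w) A) (1 / q) \<le> ennreal K * I"
  proof (cases "I = \<infinity>")
    case True
    then show ?thesis using K by (simp add: ennreal_mult_top)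
  next
    case False
    then obtain i where i: "0 \<le> i" "I = ennreal i" by (cases I) auto
    define b where "b = K * i"
    have b: "0 \<le> b" "ennreal K * I = ennreal b"
      using K i by (simp_all add: b_def ennreal_mult)
    have "emeasure (density M w) (A \<inter> B k) \<le> ennreal (b powr q)" for k
    proof -
      have fk: "emeasure (density M w) (A \<inter> B k) < \<infinity>"
        by (rule le_less_trans[OF emeasure_mono fin[of k]]) (use B in auto)
      define m where "m = measure (density M w) (A \<inter> B k)"
      have "ennreal (m powr (1 / q)) \<le> ennreal b"
        unfolding b(2)[symmetric] I_def K_def m_def
        using A B fk le by (intro weak_type_integral_set) auto
      then have "m powr (1 / q) \<le> b" using b by (simp add: ennreal_le_iff)
      then have "(m powr (1 / q)) powr q \<le> b powr q"
        using q by (intro powr_mono2) auto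
      then have "m \<le> b powr q" using q by (simp add: powr_powr m_def)
      then show ?thesis
        using fk by (simp add: emeasure_eq_ennreal_measure m_def ennreal_leI)
    qed
    moreover have "emeasure (density M w) A = (SUP k. emeasure (density M w) (A \<inter> B k))"
    proof -
      have "(\<Union>k. A \<inter> B k) = A" using B by auto
      moreover have "incseq (\<lambda>k. A \<inter> B k)" using B(2) by (auto simp: incseq_def)
      ultimately show ?thesis
        using A B(1) SUP_emeasure_incseq[of "\<lambda>k. A \<inter> B k" "density M w"] by (simp add: image_subset_iff)
    qed
    ultimately have "emeasure (density M w) A \<le> ennreal (b powr q)"
      by (simp add: SUP_le_iff)
    then obtain m where m: "0 \<le> m" "emeasure (density M w) A = ennreal m" "m \<le> b powr q"
      by (cases "emeasure (density M w) A") (auto simp: ennreal_le_iff top_unique)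
    have "m powr (1 / q) \<le> (b powr q) powr (1 / q)"
      using m q by (intro powr_mono2) auto
    then have "m powr (1 / q) \<le> b" using q b by (simp add: powr_powr)
    then show ?thesis using m b by (simp add: ennreal_powr_def ennreal_leI)
  qed
  then show ?thesis by (simp add: K_def I_def)
qed

end

section \<open>Fractional integrals with an \<open>A_1\<close> weight and a power weight\<close>

lemma measurable_lebesgue_ident:
  "(\<lambda>x. x) \<in> (lebesgue :: 'a::euclidean_space measure) \<rightarrow>\<^sub>M borel"
  by (rule measurable_completion) simp

text \<open>The sigma-algebra is the product of two completions, so the projections are first turned
  into Borel-valued maps, for which the norm of the difference is measurable.\<close>

lemma fractional_kernel_measurable [measurable]:
  "(\<lambda>(x, y). norm (x - y) powr c) \<in> borel_measurable
    ((lebesgue :: 'a::euclidean_space measure) \<Otimes>\<^sub>M (lebesgue :: 'a measure))"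
proof -
  note [measurable] = measurable_lebesgue_ident
  have [measurable]: "fst \<in> (lebesgue :: 'a measure) \<Otimes>\<^sub>M (lebesgue :: 'a measure) \<rightarrow>\<^sub>M borel"
    "snd \<in> (lebesgue :: 'a measure) \<Otimes>\<^sub>M (lebesgue :: 'a measure) \<rightarrow>\<^sub>M borel"
    using measurable_compose[OF measurable_fst, of "\<lambda>x. x" lebesgue borel lebesgue]
      measurable_compose[OF measurable_snd, of "\<lambda>x. x" lebesgue borel lebesgue] by simp_all
  show ?thesis by measurable
qed

lemma fractional_kernel_measurable_section:
  fixes x :: "'a::euclidean_space"
  shows "(\<lambda>y. norm (x - y) powr c) \<in> borel_measurable lebesgue"
proof -
  note [measurable] = measurable_lebesgue_ident
  show ?thesis by measurable
qed

text \<open>Weak Minkowski is applied to the kernels \<open>h x y\<close> and the measure with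
  density \<open>w\<close>. Because \<open>(\<alpha> - n) * q = - n\<close>, raising
  \<open>s < h x y\<close> to the power \<open>q\<close> gives the domain in
  \<open>A1_kernel_bound\<close> with \<open>s powr q\<close> for \<open>s\<close>; hence each
  kernel has weak \<open>L^q\<close> constant \<open>D * u y\<close>.\<close>

lemma fractional_integral_weak_type:
  fixes u :: "real ^ 'n \<Rightarrow> real" and \<alpha> \<beta> q :: real
  assumes u: "A1_weight u" and \<alpha>: "0 < \<alpha>" "\<alpha> < CARD('n)"
    and q: "q = CARD('n) / (CARD('n) - \<alpha>)" and \<beta>: "\<beta> < - real CARD('n)"
  obtains C where "0 < C" and "\<And>t (g :: real ^ 'n \<Rightarrow> ennreal). 0 < t \<Longrightarrow> g \<in> borel_measurable lebesgue \<Longrightarrow>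
    ennreal_powr (weighted_measure (\<lambda>x. u x * (norm x powr \<beta>) powr q)
      {x. x \<noteq> 0 \<and> ennreal t < (\<integral>\<^sup>+y. ennreal (norm (x - y) powr (\<alpha> - CARD('n)) / norm x powr \<beta>) * g y \<partial>lebesgue)}) (1 / q)
    \<le> ennreal (C / t) * (\<integral>\<^sup>+y. ennreal (u y powr (1 / q)) * g y \<partial>lebesgue)"
proof -
  define n where "n = CARD('n)"
  have n: "1 \<le> n" by (simp add: n_def Suc_leI)
  have q1: "1 < q" using \<alpha> by (simp add: q field_simps)
  have nq: "(\<alpha> - n) * q = - real n" using \<alpha> by (simp add: q n_def field_simps)
  define \<gamma> where "\<gamma> = - \<beta> * q"
  have "n * q < \<gamma>" unfolding \<gamma>_def using \<beta> q1 by (intro mult_strict_right_mono) (auto simp: n_def)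
  moreover have "real n * 1 \<le> n * q" using q1 n by (intro mult_left_mono) auto
  ultimately have \<gamma>: "real n < \<gamma>" by simp
  have wgt: "weight u" using u by (simp add: A1_weight_def)
  then have lu: "locally_integrable u" by (simp add: weight_def)
  have um[measurable]: "u \<in> borel_measurable lebesgue" by (rule locally_integrable_measurable[OF lu])
  have upos: "AE x in lebesgue. 0 < u x" using wgt by (simp add: weight_def)
  obtain C where C: "0 < C"
    and ball: "AE y in lebesgue. \<forall>z R. 0 < R \<longrightarrow> norm (z - y) \<le> R \<longrightarrow>
      (\<integral>\<^sup>+x\<in>cball z R. ennreal (u x) \<partial>lebesgue) \<le> ennreal (C * R ^ CARD('n) * u y)"
    using A1_weight_cball[OF u] by blast
  define D where "D = C * (4 powr \<gamma> + 4 ^ n / (1 - 2 powr (n - \<gamma>)))"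
  have D: "0 < D" using C \<gamma> two_powr_less_one[of "n - \<gamma>"] by (auto simp: D_def intro!: mult_pos_pos add_pos_nonneg)
  define w where "w = (\<lambda>x. ennreal (u x * (norm x powr \<beta>) powr q))"
  note [measurable] = measurable_lebesgue_ident
  have wm[measurable]: "w \<in> borel_measurable lebesgue" unfolding w_def by measurable
  have w_eq: "w x = ennreal (u x * norm x powr - \<gamma>)" for x
    by (simp add: w_def \<gamma>_def powr_powr)
  define h where "h = (\<lambda>x y :: real ^ 'n. norm (x - y) powr (\<alpha> - n) / norm x powr \<beta>)"
  have hm[measurable]: "case_prod h \<in> borel_measurable (lebesgue \<Otimes>\<^sub>M lebesgue)"
  proof -
    have "(\<lambda>x. norm (fst x) powr \<beta>) \<in> borel_measurable
        ((lebesgue :: (real ^ 'n) measure) \<Otimes>\<^sub>M (lebesgue :: (real ^ 'n) measure))"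
      by (rule measurable_compose[OF measurable_fst]) measurable
    moreover have "case_prod h = (\<lambda>p. (case p of (x, y) \<Rightarrow> norm (x - y) powr (\<alpha> - n)) / norm (fst p) powr \<beta>)"
      by (auto simp: h_def)
    ultimately show ?thesis by simp
  qed
  \<comment> \<open>The kernel bound needs \<open>y\<close> different from the origin, which
    discards only a null set.\<close>
  have "AE y in (lebesgue :: (real ^ 'n) measure). y \<notin> {0}"
    by (rule AE_not_in) simp
  then have weak: "AE y in lebesgue. 0 < D * u y \<and>
      (\<forall>s>0. emeasure (density lebesgue w) {x \<in> space lebesgue. s < h x y} \<le> ennreal (D * u y * s powr - q))"
    using upos ball
  proof eventually_elim
    case (elim y)
    have "emeasure (density lebesgue w) {x \<in> space lebesgue. s < h x y} \<le> ennreal (D * u y * s powr - q)"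
      if s: "0 < s" for s
    proof -
      have "y \<in> space lebesgue" by simp
      then have "{x \<in> space lebesgue. s < h x y} \<in> sets lebesgue" by measurable
      then have "emeasure (density lebesgue w) {x \<in> space lebesgue. s < h x y}
          = (\<integral>\<^sup>+x\<in>{x. s < h x y}. w x \<partial>lebesgue)"
        by (simp add: emeasure_density)
      also have "\<dots> \<le> (\<integral>\<^sup>+x\<in>{x. x \<noteq> 0 \<and> s powr q * norm (x - y) ^ n < norm x powr \<gamma>}.
          ennreal (u x * norm x powr - \<gamma>) \<partial>lebesgue)"
      proof (intro nn_integral_mono)
        fix x :: "real ^ 'n"
        have "s powr q * norm (x - y) ^ n < norm x powr \<gamma>" if x: "x \<noteq> 0" and sx: "s < h x y"
        proof -
          have xy: "x \<noteq> y" using sx s by (auto simp: h_def)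
          have "s powr q < h x y powr q" using s sx q1 by (intro powr_less_mono2) auto
          also have "\<dots> = norm x powr \<gamma> / norm (x - y) ^ n"
          proof -
            have "(norm (x - y) powr (\<alpha> - n)) powr q = norm (x - y) powr - real n"
              by (simp add: powr_powr nq)
            moreover have "(norm x powr \<beta>) powr q = norm x powr - \<gamma>" by (simp add: powr_powr \<gamma>_def)
            ultimately show ?thesis
              using xy x by (simp add: h_def powr_divide powr_minus_divide powr_realpow)
          qed
          finally show ?thesis using xy by (simp add: field_simps)
        qed
        \<comment> \<open>As \<open>0 powr \<beta> = 0\<close>, the density vanishes at the origin,
          and this point may be left out of the domain.\<close>
        moreover have "w 0 = 0" by (simp add: w_def)
        ultimately show "w x * indicator {x. s < h x y} x \<le> ennreal (u x * norm x powr - \<gamma>) *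
            indicator {x. x \<noteq> 0 \<and> s powr q * norm (x - y) ^ n < norm x powr \<gamma>} x"
          by (cases "x = 0") (auto simp: w_eq indicator_def)
      qed
      also have "\<dots> \<le> ennreal (C * (4 powr \<gamma> + 4 ^ n / (1 - 2 powr (n - \<gamma>))) * u y / s powr q)"
        unfolding n_def using elim C s \<gamma> by (intro A1_kernel_bound) (auto simp: n_def)
      finally show ?thesis
        by (simp add: D_def powr_minus_divide)
    qed
    then show ?case using elim D by auto
  qed
  define K where "K = 1 + 2 / (1 - 2 powr (1 - q))"
  have K: "0 < K" using weak_type_const_pos[OF q1] by (simp add: K_def)
  \<comment> \<open>The integral of \<open>w\<close> over balls around the origin is not controlled.
    These shells avoid both the origin and infinity, so \<open>w\<close> has finite integral over
    each, and they exhaust all nonzero points.\<close>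
  define B where "B k = cball 0 (real k) - ball (0 :: real ^ 'n) (1 / Suc k)" for k
  have "ennreal_powr (weighted_measure (\<lambda>x. u x * (norm x powr \<beta>) powr q)
      {x. x \<noteq> 0 \<and> ennreal t < (\<integral>\<^sup>+y. ennreal (norm (x - y) powr (\<alpha> - CARD('n)) / norm x powr \<beta>) * g y \<partial>lebesgue)}) (1 / q)
    \<le> ennreal (K * D powr (1 / q) / t) * (\<integral>\<^sup>+y. ennreal (u y powr (1 / q)) * g y \<partial>lebesgue)"
    if t: "0 < t" and g[measurable]: "g \<in> borel_measurable lebesgue" for t g
  proof -
    interpret L: sigma_finite_measure "lebesgue :: (real ^ 'n) measure" by (rule sigma_finite_lebesgue)
    define A where "A = {x \<in> space lebesgue. x \<noteq> 0 \<and> ennreal t < (\<integral>\<^sup>+y. ennreal (h x y) * g y \<partial>lebesgue)}"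
    have Am[measurable]: "A \<in> sets lebesgue"
      unfolding A_def by measurable
    have "ennreal_powr (emeasure (density lebesgue w) A) (1 / q)
      \<le> ennreal (K / t) * (\<integral>\<^sup>+y. ennreal ((D * u y) powr (1 / q)) * g y \<partial>lebesgue)"
      unfolding K_def
    proof (rule weak_type_integral[where B = B and h = h and g = g])
      show "AE y in lebesgue. 0 < D * u y \<and>
        (\<forall>s>0. emeasure (density lebesgue w) {x \<in> space lebesgue. s < h x y} \<le> ennreal (D * u y * s powr - q))"
        by (rule weak)
      show "A \<in> sets lebesgue" by (rule Am)
      show "incseq B"
      proof (rule incseq_SucI)
        fix k
        have "1 / real (Suc (Suc k)) \<le> 1 / real (Suc k)" by (intro divide_left_mono) auto
        then show "B k \<subseteq> B (Suc k)" by (auto simp: B_def)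
      qed
      show "A \<subseteq> (\<Union>k. B k)"
      proof
        fix x assume "x \<in> A"
        then have x: "0 < norm x" by (simp add: A_def)
        obtain k1 where k1: "norm x \<le> real k1" using real_arch_simple by blast
        obtain k2 where k2: "1 / real (Suc k2) < norm x"
          using reals_Archimedean[OF x] by (auto simp: inverse_eq_divide)
        have "1 / real (Suc (max k1 k2)) \<le> 1 / real (Suc k2)" by (intro divide_left_mono) auto
        then have "x \<in> B (max k1 k2)" using k1 k2 by (auto simp: B_def)
        then show "x \<in> (\<Union>k. B k)" by blast
      qed
      fix k
      show Bm: "B k \<in> sets lebesgue" by (auto simp: B_def)
      have "emeasure (density lebesgue w) (B k) = (\<integral>\<^sup>+x\<in>B k. w x \<partial>lebesgue)"
        using Bm by (simp add: emeasure_density)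
      also have "\<dots> \<le> (\<integral>\<^sup>+x. ennreal ((1 / Suc k) powr - \<gamma>) * (ennreal (u x) * indicator (cball 0 (real k)) x) \<partial>lebesgue)"
      proof (intro nn_integral_mono)
        fix x :: "real ^ 'n"
        show "w x * indicator (B k) x \<le> ennreal ((1 / Suc k) powr - \<gamma>) * (ennreal (u x) * indicator (cball 0 (real k)) x)"
        proof (cases "x \<in> B k")
          case True
          then have "norm x powr - \<gamma> \<le> (1 / Suc k) powr - \<gamma>"
            using \<gamma> by (intro powr_mono2') (auto simp: B_def)
          then have "w x \<le> ennreal ((1 / Suc k) powr - \<gamma>) * ennreal (u x)"
            by (simp add: w_eq ennreal_mult'' mult.commute[of "ennreal (u x)"] mult_right_mono ennreal_leI)
          then show ?thesis using True by (simp add: B_def)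
        qed simp
      qed
      also have "\<dots> = ennreal ((1 / Suc k) powr - \<gamma>) * (\<integral>\<^sup>+x\<in>cball 0 (real k). ennreal (u x) \<partial>lebesgue)"
      proof (rule nn_integral_cmult)
        have [measurable]: "cball 0 (real k) \<in> sets (lebesgue :: (real ^ 'n) measure)" by simp
        show "(\<lambda>x. ennreal (u x) * indicator (cball 0 (real k)) x) \<in> borel_measurable lebesgue"
          by measurable
      qed
      also have "\<dots> < \<infinity>"
      proof -
        have "set_integrable lebesgue (cball 0 (real k)) u" using lu by (simp add: locally_integrable_def)
        then have "(\<integral>\<^sup>+x. ennreal (norm (indicat_real (cball 0 (real k)) x *\<^sub>R u x)) \<partial>lebesgue) < \<infinity>"
          by (simp add: set_integrable_def integrable_iff_bounded)
        moreover have "(\<integral>\<^sup>+x\<in>cball 0 (real k). ennreal (u x) \<partial>lebesgue)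
            \<le> (\<integral>\<^sup>+x. ennreal (norm (indicat_real (cball 0 (real k)) x *\<^sub>R u x)) \<partial>lebesgue)"
          by (intro nn_integral_mono) (auto simp: indicator_def intro!: ennreal_leI)
        ultimately show ?thesis by (auto simp: ennreal_mult_less_top dest: le_less_trans)
      qed
      finally show "emeasure (density lebesgue w) (B k) < \<infinity>" .
    qed (use q1 t in \<open>auto simp: A_def sigma_finite_lebesgue\<close>)
    also have "(\<integral>\<^sup>+y. ennreal ((D * u y) powr (1 / q)) * g y \<partial>lebesgue)
        = (\<integral>\<^sup>+y. ennreal (D powr (1 / q)) * (ennreal (u y powr (1 / q)) * g y) \<partial>lebesgue)"
      by (rule nn_integral_cong_AE, use upos in eventually_elim)
        (use D in \<open>simp add: powr_mult ennreal_mult mult.assoc\<close>)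
    also have "\<dots> = ennreal (D powr (1 / q)) * (\<integral>\<^sup>+y. ennreal (u y powr (1 / q)) * g y \<partial>lebesgue)"
      by (rule nn_integral_cmult) measurable
    finally have "ennreal_powr (emeasure (density lebesgue w) A) (1 / q)
      \<le> ennreal (K * D powr (1 / q) / t) * (\<integral>\<^sup>+y. ennreal (u y powr (1 / q)) * g y \<partial>lebesgue)"
      using K t by (simp add: ennreal_mult'[symmetric] mult.assoc[symmetric])
    moreover have "emeasure (density lebesgue w) A = weighted_measure (\<lambda>x. u x * (norm x powr \<beta>) powr q) A"
      using Am by (simp add: emeasure_density weighted_measure_def w_def)
    ultimately show ?thesis by (simp add: A_def h_def n_def)
  qed
  then show ?thesis using that[of "K * D powr (1 / q)"] K D by simp
qed

section \<open>Principal values and commutators\<close>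

lemma has_principal_value_unique:
  assumes "has_principal_value K f x l" "has_principal_value K f x l'"
  shows "l = l'"
  using assms unfolding has_principal_value_def
  by (meson tendsto_unique trivial_limit_at_right_real)

lemma principal_value_eq:
  assumes "has_principal_value K f x l"
  shows "principal_value K f x = l"
proof -
  have "(THE l. has_principal_value K f x l) = l"
    using assms has_principal_value_unique by (intro the_equality) blast+
  then show ?thesis using assms by (auto simp: principal_value_def)
qed

lemma principal_value_undefined:
  assumes "\<not> (\<exists>l. has_principal_value K f x l)"
  shows "principal_value K f x = 0"
  unfolding principal_value_def using assms by (rule if_not_P)

lemma has_principal_value_cmult:
  assumes "has_principal_value K f x l"
  shows "has_principal_value K (\<lambda>y. c * f y) x (c * l)"
proof -
  have e: "K x y * (c * f y) = c * (K x y * f y)" for y by simp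
  show ?thesis
    using assms unfolding has_principal_value_def e
    by (auto intro!: tendsto_mult_left simp: set_integral_mult_right)
qed

lemma has_principal_value_add:
  assumes "has_principal_value K f x l" "has_principal_value K g x l'"
  shows "has_principal_value K (\<lambda>y. f y + g y) x (l + l')"
proof -
  have lim: "((\<lambda>\<epsilon>. (LINT y:{y. norm (y - x) > \<epsilon>}|lebesgue. K x y * f y) +
      (LINT y:{y. norm (y - x) > \<epsilon>}|lebesgue. K x y * g y)) \<longlongrightarrow> l + l') (at_right 0)"
    using assms by (intro tendsto_add) (auto simp: has_principal_value_def)
  have "((\<lambda>\<epsilon>. LINT y:{y. norm (y - x) > \<epsilon>}|lebesgue. K x y * f y + K x y * g y) \<longlongrightarrow> l + l') (at_right 0)"
  proof (rule Lim_transform_eventually[OF lim])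
    show "\<forall>\<^sub>F \<epsilon> in at_right 0. (LINT y:{y. norm (y - x) > \<epsilon>}|lebesgue. K x y * f y) +
        (LINT y:{y. norm (y - x) > \<epsilon>}|lebesgue. K x y * g y)
        = (LINT y:{y. norm (y - x) > \<epsilon>}|lebesgue. K x y * f y + K x y * g y)"
      using eventually_at_right_less[of "0::real"]
    proof eventually_elim
      case (elim \<epsilon>)
      then show ?case
        using assms by (intro set_integral_add(2)[symmetric]) (auto simp: has_principal_value_def)
    qed
  qed
  then show ?thesis
    using assms by (auto simp: has_principal_value_def distrib_left intro!: set_integral_add(1))
qed

lemma has_principal_value_diff:
  assumes "has_principal_value K f x l" "has_principal_value K g x l'"
  shows "has_principal_value K (\<lambda>y. f y - g y) x (l - l')"
  using has_principal_value_add[OF assms(1) has_principal_value_cmult[OF assms(2), of "- 1"]] by simp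

text \<open>Homogeneity survives the default value \<open>0\<close>: for \<open>c \<noteq> 0\<close>
  the principal values of \<open>f\<close> and of its multiple exist together, and for
  \<open>c = 0\<close> both sides vanish.\<close>

lemma principal_value_cmult:
  "principal_value K (\<lambda>y. c * f y) x = c * principal_value K f x"
proof (cases "\<exists>l. has_principal_value K f x l")
  case True
  then obtain l where l: "has_principal_value K f x l" by blast
  then show ?thesis
    using has_principal_value_cmult[OF l] by (simp add: principal_value_eq)
next
  case False
  show ?thesis
  proof (cases "c = 0")
    case True
    have "has_principal_value K (\<lambda>y. 0) x 0"
      by (simp add: has_principal_value_def set_integrable_def)
    then show ?thesis using True by (simp add: principal_value_eq)
  next
    case c: False
    have "\<not> (\<exists>l. has_principal_value K (\<lambda>y. c * f y) x l)"
    proof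
      assume "\<exists>l. has_principal_value K (\<lambda>y. c * f y) x l"
      then obtain l where "has_principal_value K (\<lambda>y. c * f y) x l" by blast
      from has_principal_value_cmult[OF this, of "inverse c"] c False
      show False by (auto simp: mult.assoc[symmetric])
    qed
    then show ?thesis using False by (auto simp: principal_value_def)
  qed
qed

text \<open>Every truncated integral obeys the bound, which then passes to the limit. If there is no
  limit, the default value \<open>0\<close> obeys it trivially; no integrability is assumed.\<close>

lemma norm_principal_value_le:
  "ennreal (norm (principal_value K f x)) \<le> (\<integral>\<^sup>+y. ennreal (norm (K x y * f y)) \<partial>lebesgue)"
proof (cases "\<exists>l. has_principal_value K f x l")
  case False
  then show ?thesis by (auto simp: principal_value_def)
next
  case True
  then obtain l where l: "has_principal_value K f x l" by blast
  define I where "I = (\<integral>\<^sup>+y. ennreal (norm (K x y * f y)) \<partial>lebesgue)"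
  have "ennreal (norm l) \<le> I"
  proof (cases "I = \<infinity>")
    case False
    then obtain i where i: "0 \<le> i" "I = ennreal i" by (cases I) auto
    have le: "norm (LINT y:{y. norm (y - x) > \<epsilon>}|lebesgue. K x y * f y) \<le> i" if "0 < \<epsilon>" for \<epsilon>
    proof -
      have "ennreal (norm (LINT y:{y. norm (y - x) > \<epsilon>}|lebesgue. K x y * f y))
          \<le> (\<integral>\<^sup>+y. ennreal (norm (indicat_real {y. norm (y - x) > \<epsilon>} y *\<^sub>R (K x y * f y))) \<partial>lebesgue)"
        unfolding set_lebesgue_integral_def using l that
        by (intro integral_norm_bound_ennreal) (auto simp: has_principal_value_def set_integrable_def)
      also have "\<dots> \<le> I"
        unfolding I_def by (intro nn_integral_mono) (auto simp: indicator_def)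
      finally show ?thesis using i by (simp add: ennreal_le_iff)
    qed
    have "((\<lambda>\<epsilon>. norm (LINT y:{y. norm (y - x) > \<epsilon>}|lebesgue. K x y * f y)) \<longlongrightarrow> norm l) (at_right 0)"
      using l by (intro tendsto_norm) (simp add: has_principal_value_def)
    moreover have "\<forall>\<^sub>F \<epsilon> in at_right 0. norm (LINT y:{y. norm (y - x) > \<epsilon>}|lebesgue. K x y * f y) \<le> i"
      using eventually_at_right_less[of "0::real"] by eventually_elim (rule le)
    ultimately have "norm l \<le> i"
      by (rule tendsto_upperbound) simp
    then show ?thesis using i by (simp add: ennreal_leI)
  qed simp
  then show ?thesis using l by (simp add: principal_value_eq I_def)
qed

text \<open>Dominated convergence along any sequence of radii tending to \<open>0\<close>; the
  truncations miss only the point \<open>x\<close>, a null set.\<close>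

lemma integrable_has_principal_value:
  assumes int: "integrable lebesgue (\<lambda>y. K x y * f y)"
  shows "has_principal_value K f x (LINT y|lebesgue. K x y * f y)"
  unfolding has_principal_value_def
proof (intro conjI allI impI)
  have m[measurable]: "{y. norm (y - x) > \<epsilon>} \<in> sets lebesgue" for \<epsilon>
  proof -
    have "open {y. norm (y - x) > \<epsilon>}" by (intro open_Collect_less continuous_intros)
    then show ?thesis by simp
  qed
  show "set_integrable lebesgue {y. norm (y - x) > \<epsilon>} (\<lambda>y. K x y * f y)" for \<epsilon>
    unfolding set_integrable_def using int m by (intro integrable_mult_indicator)
  show "((\<lambda>\<epsilon>. LINT y:{y. norm (y - x) > \<epsilon>}|lebesgue. K x y * f y) \<longlongrightarrow> (LINT y|lebesgue. K x y * f y)) (at_right 0)"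
  proof (rule tendsto_at_right_sequentially[of 0 1])
    fix S :: "nat \<Rightarrow> real" assume S: "\<And>n. 0 < S n" "S \<longlonglongrightarrow> 0"
    show "(\<lambda>n. LINT y:{y. norm (y - x) > S n}|lebesgue. K x y * f y) \<longlonglongrightarrow> (LINT y|lebesgue. K x y * f y)"
      unfolding set_lebesgue_integral_def
    proof (rule integral_dominated_convergence[where w = "\<lambda>y. norm (K x y * f y)"])
      show "(\<lambda>y. K x y * f y) \<in> borel_measurable lebesgue" using int by simp
      then show "(\<lambda>y. indicat_real {y. norm (y - x) > S n} y *\<^sub>R (K x y * f y)) \<in> borel_measurable lebesgue" for n
        by measurable
      show "integrable lebesgue (\<lambda>y. norm (K x y * f y))" using int by simp
      have "AE y in lebesgue. y \<notin> {x}" by (rule AE_not_in) simp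
      then show "AE y in lebesgue. (\<lambda>n. indicat_real {y. norm (y - x) > S n} y *\<^sub>R (K x y * f y)) \<longlonglongrightarrow> K x y * f y"
      proof eventually_elim
        case (elim y)
        then have "\<forall>\<^sub>F n in sequentially. S n < norm (y - x)"
          using order_tendstoD(2)[OF S(2)] by simp
        then have "\<forall>\<^sub>F n in sequentially. indicat_real {y. norm (y - x) > S n} y *\<^sub>R (K x y * f y) = K x y * f y"
          by eventually_elim simp
        then show ?case by (rule tendsto_eventually)
      qed
      show "AE y in lebesgue. norm (indicat_real {y. norm (y - x) > S n} y *\<^sub>R (K x y * f y)) \<le> norm (K x y * f y)" for n
        by (auto simp: indicator_def)
    qed
  qed simp
qed

section \<open>Iterated commutators of the principal value operator\<close>

text \<open>The recursion multiplies the function either by the number \<open>b x\<close> or by the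
  function \<open>b\<close>, and the difference produces one more factor \<open>b x - b y\<close>.
  Assuming existence for all powers \<open>k\<close> makes the hypothesis stable under passing from
  \<open>f\<close> to \<open>b\<close> times \<open>f\<close>.\<close>

lemma higher_commutator_has_principal_value:
  assumes "\<And>k. \<exists>l. has_principal_value K (\<lambda>y. b y ^ k * f y) x l"
  shows "has_principal_value K (\<lambda>y. (b x - b y) ^ m * f y) x (higher_commutator m b (principal_value K) f x)"
  using assms
proof (induction m arbitrary: f)
  case 0
  from 0[of 0] obtain l where "has_principal_value K f x l" by auto
  then show ?case by (simp add: principal_value_eq)
next
  case (Suc m)
  have "\<exists>l. has_principal_value K (\<lambda>y. b y ^ k * (b y * f y)) x l" for k
    using Suc.prems[of "Suc k"] by (simp add: mult_ac)
  then have 1: "has_principal_value K (\<lambda>y. (b x - b y) ^ m * (b y * f y)) x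
      (higher_commutator m b (principal_value K) (\<lambda>y. b y * f y) x)"
    by (rule Suc.IH)
  have 2: "has_principal_value K (\<lambda>y. (b x - b y) ^ m * f y) x (higher_commutator m b (principal_value K) f x)"
    by (rule Suc.IH[OF Suc.prems])
  have "(\<lambda>y. (b x - b y) ^ Suc m * f y) = (\<lambda>y. b x * ((b x - b y) ^ m * f y) - (b x - b y) ^ m * (b y * f y))"
    by (simp add: algebra_simps)
  then show ?case
    using has_principal_value_diff[OF has_principal_value_cmult[OF 2, of "b x"] 1]
    by (simp add: commutator_def)
qed

lemma higher_commutator_no_principal_value:
  assumes "\<And>k. \<not> (\<exists>l. has_principal_value K (\<lambda>y. b y ^ k * f y) x l)"
  shows "higher_commutator m b (principal_value K) f x = 0"
  using assms
proof (induction m arbitrary: f)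
  case 0
  have "\<not> (\<exists>l. has_principal_value K f x l)" using 0[of 0] by simp
  then show ?case by (simp add: principal_value_undefined)
next
  case (Suc m)
  have "\<not> (\<exists>l. has_principal_value K (\<lambda>y. b y ^ k * (b y * f y)) x l)" for k
    using Suc.prems[of "Suc k"] by (simp add: mult_ac)
  from Suc.IH[OF this] Suc.IH[OF Suc.prems] show ?case
    by (simp add: commutator_def)
qed

text \<open>At a zero of \<open>b\<close> only the second term of each commutator survives, so up to
  sign the operator is applied once to \<open>b ^ m\<close> times \<open>f\<close>.\<close>

lemma higher_commutator_zero_symbol:
  assumes "b x = 0"
  shows "norm (higher_commutator m b T f x) = norm (T (\<lambda>y. b y ^ m * f y) x)"
  using assms by (induction m arbitrary: f) (simp_all add: commutator_def mult_ac)

text \<open>The principal values of the \<open>b\<^sup>k f\<close> either all exist, or (if \<open>b x \<noteq> 0\<close>) none does, in which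
  case the junk value \<open>0\<close> of \<^const>\<open>principal_value\<close> makes the commutator vanish. So the existence
  of principal values of integrable functions is not needed.\<close>

lemma norm_higher_commutator_principal_value_le:
  assumes int: "\<And>k. integrable lebesgue (\<lambda>y. K x y * ((b y ^ k - b x ^ k) * f y))"
  shows "ennreal (norm (higher_commutator m b (principal_value K) f x))
    \<le> (\<integral>\<^sup>+y. ennreal (norm (K x y * ((b x - b y) ^ m * f y))) \<partial>lebesgue)"
proof -
  have diff: "\<exists>l. has_principal_value K (\<lambda>y. (b y ^ k - b x ^ k) * f y) x l" for k
    using integrable_has_principal_value[of K x "\<lambda>y. (b y ^ k - b x ^ k) * f y", OF int] by blast
  \<comment> \<open>A zero of \<open>b\<close> needs its own case: existence for
    \<open>b y ^ k * f y\<close> cannot then be divided back to existence for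
    \<open>f\<close>.\<close>
  consider "\<exists>l. has_principal_value K f x l" | "b x = 0"
    | "\<not> (\<exists>l. has_principal_value K f x l)" "b x \<noteq> 0" by blast
  then show ?thesis
  proof cases
    case 1
    then obtain l where l: "has_principal_value K f x l" by blast
    have "\<exists>l. has_principal_value K (\<lambda>y. b y ^ k * f y) x l" for k
    proof -
      obtain l' where "has_principal_value K (\<lambda>y. (b y ^ k - b x ^ k) * f y) x l'" using diff by blast
      from has_principal_value_add[OF this has_principal_value_cmult[OF l, of "b x ^ k"]]
      show ?thesis by (auto simp: algebra_simps)
    qed
    then have "principal_value K (\<lambda>y. (b x - b y) ^ m * f y) x = higher_commutator m b (principal_value K) f x"
      by (intro principal_value_eq higher_commutator_has_principal_value)
    then show ?thesis
      using norm_principal_value_le[of K "\<lambda>y. (b x - b y) ^ m * f y" x] by simp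
  next
    case 2
    have "ennreal (norm (higher_commutator m b (principal_value K) f x))
        \<le> (\<integral>\<^sup>+y. ennreal (norm (K x y * (b y ^ m * f y))) \<partial>lebesgue)"
      using norm_principal_value_le[of K "\<lambda>y. b y ^ m * f y" x]
      by (simp add: higher_commutator_zero_symbol[where b = b and x = x, OF 2])
    also have "\<dots> = (\<integral>\<^sup>+y. ennreal (norm (K x y * ((b x - b y) ^ m * f y))) \<partial>lebesgue)"
      using 2 by (simp add: norm_mult norm_power)
    finally show ?thesis .
  next
    case 3
    have "\<not> (\<exists>l. has_principal_value K (\<lambda>y. b y ^ k * f y) x l)" for k
    proof
      assume "\<exists>l. has_principal_value K (\<lambda>y. b y ^ k * f y) x l"
      then obtain l l' where l: "has_principal_value K (\<lambda>y. b y ^ k * f y) x l"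
        and l': "has_principal_value K (\<lambda>y. (b y ^ k - b x ^ k) * f y) x l'"
        using diff by blast
      have "(\<lambda>y. inverse (b x ^ k) * (b y ^ k * f y - (b y ^ k - b x ^ k) * f y)) = f"
        using 3 by (auto simp: algebra_simps)
      then show False
        using 3 has_principal_value_cmult[OF has_principal_value_diff[OF l l'], of "inverse (b x ^ k)"]
        by auto
    qed
    then show ?thesis by (simp add: higher_commutator_no_principal_value)
  qed
qed

text \<open>The exceptional null set may depend on the function, but a commutator of fixed order
  evaluates the operator on only finitely many functions, all measurable.\<close>

lemma higher_commutator_cong_AE:
  assumes T: "\<And>f. f \<in> borel_measurable lebesgue \<Longrightarrow> AE x in lebesgue. T f x = S f x"
    and b[measurable]: "b \<in> borel_measurable lebesgue" and f: "f \<in> borel_measurable lebesgue"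
  shows "AE x in lebesgue. higher_commutator m b T f x = higher_commutator m b S f x"
  using f
proof (induction m arbitrary: f)
  case 0
  then show ?case using T by simp
next
  case (Suc m)
  note [measurable] = Suc.prems
  have "(\<lambda>y. b y * f y) \<in> borel_measurable lebesgue" by measurable
  from Suc.IH[OF this] Suc.IH[OF Suc.prems] show ?case
    by eventually_elim (simp add: commutator_def)
qed

lemma higher_commutator_const_symbol:
  assumes "1 \<le> m"
  shows "higher_commutator m (\<lambda>_. c) (principal_value K) f x = 0"
  using assms
proof (induction m arbitrary: f)
  case (Suc m)
  then show ?case
    by (cases m) (simp_all add: commutator_def principal_value_cmult)
qed simp

section \<open>Measurable sections of the kernel and finiteness of fractional integrals\<close>

text \<open>Sections of a Lebesgue measurable function on the product are measurable only almost
  everywhere: it is replaced by a Borel function that agrees with it almost everywhere. Extending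
  \<open>K\<close> by \<open>0\<close> to the diagonal changes each section at a single
  point.\<close>

lemma standard_kernel_measurable_section:
  fixes K :: "real ^ 'n \<Rightarrow> real ^ 'n \<Rightarrow> complex"
  assumes "standard_kernel K"
  shows "AE x in lebesgue. K x \<in> borel_measurable lebesgue"
proof -
  define G where "G = (\<lambda>p. if p \<in> {(x, y). x \<noteq> y} then case_prod K p else 0)"
  have op: "open {(x, y). x \<noteq> (y :: real ^ 'n)}"
  proof -
    have "{(x, y). x \<noteq> (y :: real ^ 'n)} = {p. fst p \<noteq> snd p}" by auto
    then show ?thesis by (simp add: open_Collect_neq continuous_on_fst continuous_on_snd continuous_on_id)
  qed
  have "case_prod K \<in> borel_measurable (lebesgue_on {(x, y). x \<noteq> y})"
    using assms by (simp add: standard_kernel_def)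
  then have G: "G \<in> borel_measurable lebesgue"
    unfolding G_def using op by (subst borel_measurable_if) auto
  \<comment> \<open>The Borel representative is taken for real-valued functions;
    \<open>\<phi>\<close> is later the real and the imaginary part.\<close>
  have "AE x in lebesgue. (\<lambda>y. \<phi> (K x y)) \<in> borel_measurable lebesgue"
    if \<phi>: "\<phi> \<in> borel_measurable borel" for \<phi> :: "complex \<Rightarrow> real"
  proof -
    have "(\<lambda>p. \<phi> (G p)) \<in> borel_measurable lebesgue"
      using measurable_compose[OF G \<phi>] .
    then obtain g where g: "g \<in> borel_measurable lborel" and eq: "AE p in lborel. \<phi> (G p) = g p"
      using completion_ex_borel_measurable_real by blast
    have "AE x in lborel. AE y in lborel. \<phi> (G (x, y)) = g (x, y)"
      by (rule lborel_pair.AE_pair) (subst lborel_prod, rule eq)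
    then have "AE x in lebesgue. AE y in lborel. \<phi> (G (x, y)) = g (x, y)"
      by (rule AE_completion)
    then show ?thesis
    proof eventually_elim
      case (elim x)
      have "AE y in lebesgue. y \<notin> {x}" by (rule AE_not_in) simp
      then have "AE y in lebesgue. g (x, y) = \<phi> (K x y)"
        using AE_completion[OF elim] by eventually_elim (auto simp: G_def)
      moreover have "(\<lambda>y. g (x, y)) \<in> borel_measurable lebesgue"
        using g by (intro measurable_completion) simp
      ultimately show ?case by (rule borel_measurable_AE[rotated])
    qed
  qed
  from this[OF borel_measurable_Re] this[OF borel_measurable_Im] show ?thesis
    by eventually_elim (simp add: borel_measurable_complex_iff)
qed

text \<open>The kernel lies in weak \<open>L^q\<close> for \<open>q = n / (n - \<alpha>)\<close>,
  uniformly in \<open>y\<close>, since its superlevel sets lie in balls around \<open>y\<close>.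
  Kolmogorov's inequality bounds its integral over a fixed ball independently of \<open>y\<close>,
  and Fubini makes the fractional integral locally integrable.\<close>

lemma fractional_integral_finite_AE:
  fixes g :: "'a::euclidean_space \<Rightarrow> ennreal" and \<alpha> :: real
  assumes g[measurable]: "g \<in> borel_measurable lebesgue" and fin: "(\<integral>\<^sup>+y. g y \<partial>lebesgue) < \<infinity>"
    and \<alpha>: "0 < \<alpha>" "\<alpha> < DIM('a)"
  shows "AE x in lebesgue. (\<integral>\<^sup>+y. ennreal (norm (x - y) powr (\<alpha> - DIM('a))) * g y \<partial>lebesgue) < \<infinity>"
proof -
  interpret L: sigma_finite_measure "lebesgue :: 'a measure" by (rule sigma_finite_lebesgue)
  interpret LL: pair_sigma_finite "lebesgue :: 'a measure" "lebesgue :: 'a measure" ..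
  define n where "n = real DIM('a)"
  define q where "q = n / (n - \<alpha>)"
  have q: "1 < q" using \<alpha> by (simp add: q_def n_def field_simps)
  define V where "V = unit_ball_vol n"
  have V: "0 < V" by (simp add: V_def n_def)
  define h where "h = (\<lambda>x y :: 'a. norm (x - y) powr (\<alpha> - n))"
  have hm[measurable]: "case_prod h \<in> borel_measurable (lebesgue \<Otimes>\<^sub>M lebesgue)"
    unfolding h_def by measurable
  define F where "F = (\<lambda>x. \<integral>\<^sup>+y. ennreal (h x y) * g y \<partial>lebesgue)"
  have Fm[measurable]: "F \<in> borel_measurable lebesgue" unfolding F_def by measurable
  have "AE x in lebesgue. F x * indicator (ball 0 (real k)) x \<noteq> \<infinity>" for k :: nat
  proof (rule nn_integral_noteq_infinite)
    define E where "E = ball (0 :: 'a) (real k)"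
    have E[measurable]: "E \<in> sets lebesgue" by (simp add: E_def)
    have Efin: "emeasure lebesgue E < \<infinity>"
      using emeasure_lborel_ball_finite by (simp add: E_def)
    show "(\<lambda>x. F x * indicator (ball 0 (real k)) x) \<in> borel_measurable lebesgue"
      unfolding E_def[symmetric] by measurable
    define c where "c = (1 + 2 / (1 - 2 powr (1 - q))) * V powr (1 / q) * measure lebesgue E powr (1 - 1 / q)"
    have inner: "(\<integral>\<^sup>+x\<in>E. ennreal (h x y) \<partial>lebesgue) \<le> ennreal c" for y
      unfolding c_def
    proof (rule weak_type_nn_integral_le[OF q V _ E Efin])
      have "y \<in> space lebesgue" by simp
      then show "(\<lambda>x. h x y) \<in> borel_measurable lebesgue" by measurable
      fix t :: real assume t: "0 < t"
      define r where "r = t powr - (1 / (n - \<alpha>))"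
      have "- (1 / (n - \<alpha>)) * (\<alpha> - n) = 1" using \<alpha> by (simp add: n_def field_simps)
      then have r: "r powr (\<alpha> - n) = t" "0 \<le> r" using t by (simp_all only: r_def powr_powr) simp_all
      have "{x \<in> space lebesgue. t < h x y} \<subseteq> ball y r"
      proof
        fix x assume "x \<in> {x \<in> space lebesgue. t < h x y}"
        then have "t < norm (x - y) powr (\<alpha> - n)" by (simp add: h_def)
        then have "\<not> r \<le> norm (x - y)"
          using powr_mono2'[of "\<alpha> - n" r "norm (x - y)"] r t \<alpha> by (auto simp: n_def r_def)
        then show "x \<in> ball y r" by (simp add: dist_norm norm_minus_commute)
      qed
      then have "emeasure lebesgue {x \<in> space lebesgue. t < h x y} \<le> emeasure lebesgue (ball y r)"
        by (intro emeasure_mono) auto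
      also have "\<dots> = ennreal (V * r ^ DIM('a))"
        using r emeasure_ball[of r y] by (simp add: V_def n_def)
      also have "r ^ DIM('a) = t powr - q"
        using t by (simp add: r_def q_def n_def powr_powr powr_realpow[symmetric])
      finally show "emeasure lebesgue {x \<in> space lebesgue. t < h x y} \<le> ennreal (V * t powr - q)" .
    qed
    have "(\<integral>\<^sup>+x. F x * indicator E x \<partial>lebesgue)
        = (\<integral>\<^sup>+x. (\<integral>\<^sup>+y. ennreal (h x y) * g y * indicator E x \<partial>lebesgue) \<partial>lebesgue)"
    proof (rule nn_integral_cong)
      fix x :: 'a assume [measurable]: "x \<in> space lebesgue"
      show "F x * indicator E x = (\<integral>\<^sup>+y. ennreal (h x y) * g y * indicator E x \<partial>lebesgue)"
        unfolding F_def by (simp add: nn_integral_multc)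
    qed
    also have "\<dots> = (\<integral>\<^sup>+y. (\<integral>\<^sup>+x. ennreal (h x y) * g y * indicator E x \<partial>lebesgue) \<partial>lebesgue)"
      by (rule LL.Fubini'[symmetric]) measurable
    also have "\<dots> \<le> (\<integral>\<^sup>+y. ennreal c * g y \<partial>lebesgue)"
    proof (rule nn_integral_mono)
      fix y :: 'a assume [measurable]: "y \<in> space lebesgue"
      have "(\<integral>\<^sup>+x. ennreal (h x y) * g y * indicator E x \<partial>lebesgue)
          = (\<integral>\<^sup>+x. ennreal (h x y) * indicator E x * g y \<partial>lebesgue)"
        by (simp add: mult_ac)
      also have "\<dots> = (\<integral>\<^sup>+x\<in>E. ennreal (h x y) \<partial>lebesgue) * g y"
        by (rule nn_integral_multc) measurable
      also have "\<dots> \<le> ennreal c * g y" by (intro mult_right_mono inner) simp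
      finally show "(\<integral>\<^sup>+x. ennreal (h x y) * g y * indicator E x \<partial>lebesgue) \<le> ennreal c * g y" .
    qed
    also have "\<dots> = ennreal c * (\<integral>\<^sup>+y. g y \<partial>lebesgue)" by (rule nn_integral_cmult) simp
    also have "\<dots> < \<infinity>" using fin by (simp add: ennreal_mult_less_top)
    finally show "(\<integral>\<^sup>+x. F x * indicator (ball 0 (real k)) x \<partial>lebesgue) \<noteq> \<infinity>"
      by (simp add: E_def)
  qed
  then have "AE x in lebesgue. \<forall>k::nat. F x * indicator (ball 0 (real k)) x \<noteq> \<infinity>"
    by (subst AE_all_countable) blast
  then show ?thesis
  proof eventually_elim
    case (elim x)
    obtain k :: nat where "norm x < real k" using reals_Archimedean2 by blast
    with elim[rule_format, of k] have "F x \<noteq> \<infinity>" by simp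
    then show ?case by (simp add: F_def h_def n_def less_top)
  qed
qed

section \<open>Estimates from the Lipschitz continuity of the symbol\<close>

text \<open>The infimum is itself an admissible bound: for \<open>x \<noteq> y\<close> the
  difference quotient is a lower bound of all admissible constants.\<close>

lemma Lip_norm_bound:
  assumes b: "b \<in> Lip_space \<delta>"
  shows "0 \<le> Lip_norm \<delta> b" and "norm (b x - b y) \<le> Lip_norm \<delta> b * norm (x - y) powr \<delta>"
proof -
  define S where "S = {C. 0 < C \<and> (\<forall>x y. norm (b x - b y) \<le> C * norm (x - y) powr \<delta>)}"
  have S: "S \<noteq> {}" using b by (auto simp: S_def Lip_space_def)
  show "0 \<le> Lip_norm \<delta> b"
    unfolding Lip_norm_def S_def[symmetric] using S by (rule cInf_greatest) (simp add: S_def)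
  show "norm (b x - b y) \<le> Lip_norm \<delta> b * norm (x - y) powr \<delta>"
  proof (cases "x = y")
    case False
    have "norm (b x - b y) / norm (x - y) powr \<delta> \<le> Lip_norm \<delta> b"
      unfolding Lip_norm_def S_def[symmetric] using S
    proof (rule cInf_greatest)
      fix C assume "C \<in> S"
      then show "norm (b x - b y) / norm (x - y) powr \<delta> \<le> C"
        using False by (auto simp: S_def divide_le_eq)
    qed
    then show ?thesis using False by (simp add: divide_le_eq)
  qed simp
qed

lemma norm_power_diff_le:
  fixes a b :: "'a::{real_normed_field}"
  assumes "norm a \<le> B" "norm b \<le> B"
  shows "norm (a ^ k - b ^ k) \<le> (\<Sum>i<k. B ^ (k - Suc i) * B ^ i) * norm (a - b)"
proof -
  have "0 \<le> B" using assms(1) norm_ge_zero order_trans by blast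
  then have "norm (\<Sum>i<k. b ^ (k - Suc i) * a ^ i) \<le> (\<Sum>i<k. B ^ (k - Suc i) * B ^ i)"
    using assms by (intro sum_norm_le) (auto simp: norm_mult norm_power intro!: mult_mono power_mono)
  then have "norm (a - b) * norm (\<Sum>i<k. b ^ (k - Suc i) * a ^ i)
      \<le> norm (a - b) * (\<Sum>i<k. B ^ (k - Suc i) * B ^ i)"
    by (intro mult_left_mono) auto
  then show ?thesis
    by (simp only: power_diff_sumr2 norm_mult mult.commute)
qed

lemma standard_kernel_size:
  fixes K :: "real ^ 'n \<Rightarrow> real ^ 'n \<Rightarrow> complex"
  assumes "standard_kernel K"
  obtains c where "0 < c"
    and "\<And>x y s. x \<noteq> y \<Longrightarrow> norm (K x y) * norm (x - y) powr s \<le> c * norm (x - y) powr (s - CARD('n))"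
proof -
  obtain c where c: "\<And>x y. x \<noteq> y \<Longrightarrow> norm (K x y) \<le> c / norm (x - y) ^ CARD('n)"
    using assms unfolding standard_kernel_def by blast
  \<comment> \<open>The maximum with \<open>1\<close> makes the constant positive, so that it can
    later be divided by.\<close>
  show ?thesis
  proof (rule that[of "max c 1"])
    fix x y :: "real ^ 'n" and s :: real assume xy: "x \<noteq> y"
    have "norm (K x y) \<le> max c 1 / norm (x - y) ^ CARD('n)"
      using c[OF xy] by (rule order_trans) (intro divide_right_mono, auto)
    then have "norm (K x y) * norm (x - y) powr s \<le> max c 1 / norm (x - y) ^ CARD('n) * norm (x - y) powr s"
      by (intro mult_right_mono) auto
    then show "norm (K x y) * norm (x - y) powr s \<le> max c 1 * norm (x - y) powr (s - CARD('n))"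
      using xy by (simp add: powr_diff powr_realpow)
  qed simp
qed

text \<open>On the bounded support of \<open>g\<close> the difference of the powers of
  \<open>b\<close> is at most a constant times \<open>norm (x - y) powr \<delta>\<close>, so the
  integrand is dominated by a fractional integral of order \<open>\<delta>\<close>. Its finiteness
  does not involve \<open>k\<close>, hence one null set serves all \<open>k\<close>.\<close>

lemma commutator_terms_integrable:
  fixes K :: "real ^ 'n \<Rightarrow> real ^ 'n \<Rightarrow> complex" and \<delta> :: real
  assumes K: "standard_kernel K" and b: "b \<in> Lip_space \<delta>" and \<delta>: "0 < \<delta>" "\<delta> < CARD('n)"
    and g: "integrable lebesgue g" and supp: "\<And>y. g y \<noteq> 0 \<Longrightarrow> norm y \<le> R"
  shows "AE x in lebesgue. \<forall>k. integrable lebesgue (\<lambda>y. K x y * ((b y ^ k - b x ^ k) * g y))"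
proof -
  obtain c where c: "0 < c"
    and Kc: "\<And>x y s. x \<noteq> y \<Longrightarrow> norm (K x y) * norm (x - y) powr s \<le> c * norm (x - y) powr (s - CARD('n))"
    using standard_kernel_size[OF K] by blast
  define L where "L = Lip_norm \<delta> b"
  have L: "0 \<le> L" "\<And>x y. norm (b x - b y) \<le> L * norm (x - y) powr \<delta>"
    using Lip_norm_bound[OF b] by (auto simp: L_def)
  have bm[measurable]: "b \<in> borel_measurable lebesgue"
    using b by (intro locally_integrable_measurable) (simp add: Lip_space_def)
  have gm[measurable]: "g \<in> borel_measurable lebesgue" using g by simp
  have "(\<integral>\<^sup>+y. ennreal (norm (g y)) \<partial>lebesgue) < \<infinity>"
    using g by (simp add: integrable_iff_bounded)
  then have "AE x in lebesgue. (\<integral>\<^sup>+y. ennreal (norm (x - y) powr (\<delta> - CARD('n))) * ennreal (norm (g y)) \<partial>lebesgue) < \<infinity>"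
    using fractional_integral_finite_AE[of "\<lambda>y. ennreal (norm (g y))" \<delta>] \<delta> by simp
  then show ?thesis
    using standard_kernel_measurable_section[OF K]
  proof eventually_elim
    case (elim x)
    note [measurable] = elim(2)
    show ?case
    proof (intro allI integrableI_bounded)
      fix k :: nat
      show "(\<lambda>y. K x y * ((b y ^ k - b x ^ k) * g y)) \<in> borel_measurable lebesgue" by measurable
      \<comment> \<open>A common bound for \<open>b x\<close> and for \<open>b y\<close> whenever
        \<open>g y \<noteq> 0\<close>; it may depend on \<open>x\<close>, as only finiteness at
        fixed \<open>x\<close> is needed.\<close>
      define B where "B = norm (b x) + L * (norm x + \<bar>R\<bar>) powr \<delta>"
      define P where "P = (\<Sum>i<k. B ^ (k - Suc i) * B ^ i)"
      have B0: "0 \<le> B" using L by (simp add: B_def)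
      then have P: "0 \<le> P" by (auto simp: P_def intro!: sum_nonneg)
      have pw: "norm (K x y * ((b y ^ k - b x ^ k) * g y))
          \<le> c * P * L * (norm (x - y) powr (\<delta> - CARD('n)) * norm (g y))" for y
      proof (cases "x = y \<or> g y = 0")
        case False
        then have "norm y \<le> R" using supp by blast
        then have "norm (x - y) \<le> norm x + \<bar>R\<bar>" using norm_triangle_ineq4[of x y] by linarith
        then have "norm (x - y) powr \<delta> \<le> (norm x + \<bar>R\<bar>) powr \<delta>" using \<delta> by (intro powr_mono2) auto
        then have "norm (b x - b y) \<le> L * (norm x + \<bar>R\<bar>) powr \<delta>"
          using L by (meson mult_left_mono order_trans)
        then have "norm (b y) \<le> B"
          using norm_triangle_sub[of "b y" "b x"] by (simp add: B_def norm_minus_commute)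
        moreover have "norm (b x) \<le> B" using L by (simp add: B_def)
        ultimately have "norm (b y ^ k - b x ^ k) \<le> P * norm (b y - b x)"
          unfolding P_def by (rule norm_power_diff_le)
        also have "\<dots> \<le> P * (L * norm (x - y) powr \<delta>)"
          using L(2)[of x y] P by (intro mult_left_mono) (auto simp: norm_minus_commute)
        finally have "norm (K x y * ((b y ^ k - b x ^ k) * g y))
            \<le> norm (K x y) * (P * (L * norm (x - y) powr \<delta>) * norm (g y))"
          by (simp add: norm_mult mult_left_mono mult_right_mono)
        also have "\<dots> = P * L * norm (g y) * (norm (K x y) * norm (x - y) powr \<delta>)"
          by (simp add: mult_ac)
        also have "\<dots> \<le> P * L * norm (g y) * (c * norm (x - y) powr (\<delta> - CARD('n)))"
          using False P L by (intro mult_left_mono Kc) auto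
        finally show ?thesis by (simp add: mult_ac)
      qed auto
      have "(\<integral>\<^sup>+y. ennreal (norm (K x y * ((b y ^ k - b x ^ k) * g y))) \<partial>lebesgue)
          \<le> (\<integral>\<^sup>+y. ennreal (c * P * L) * (ennreal (norm (x - y) powr (\<delta> - CARD('n))) * ennreal (norm (g y))) \<partial>lebesgue)"
        using c P L by (intro nn_integral_mono) (simp add: ennreal_mult[symmetric] ennreal_leI pw)
      also have "\<dots> = ennreal (c * P * L) * (\<integral>\<^sup>+y. ennreal (norm (x - y) powr (\<delta> - CARD('n))) * ennreal (norm (g y)) \<partial>lebesgue)"
      proof (rule nn_integral_cmult)
        note [measurable] = fractional_kernel_measurable_section
        show "(\<lambda>y. ennreal (norm (x - y) powr (\<delta> - CARD('n))) * ennreal (norm (g y))) \<in> borel_measurable lebesgue"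
          by measurable
      qed
      also have "\<dots> < \<infinity>" using elim(1) by (simp add: ennreal_mult_less_top)
      finally show "(\<integral>\<^sup>+y. ennreal (norm (K x y * ((b y ^ k - b x ^ k) * g y))) \<partial>lebesgue) < \<infinity>" .
    qed
  qed
qed

text \<open>The \<open>m\<close> Lipschitz factors together gain
  \<open>norm (x - y) powr (m * \<delta>)\<close>, which raises the order of the kernel singularity
  from \<open>- n\<close> to \<open>m * \<delta> - n\<close>.\<close>

lemma higher_commutator_le_fractional_integral:
  fixes K :: "real ^ 'n \<Rightarrow> real ^ 'n \<Rightarrow> complex" and \<delta> :: real
  assumes K: "\<And>x y. \<And>s :: real. x \<noteq> y \<Longrightarrow> norm (K x y) * norm (x - y) powr s \<le> c * norm (x - y) powr (s - CARD('n))"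
    and c: "0 < c" and b: "b \<in> Lip_space \<delta>" and m: "1 \<le> m"
    and int: "\<And>k. integrable lebesgue (\<lambda>y. K x y * ((b y ^ k - b x ^ k) * g y))"
    and g[measurable]: "g \<in> borel_measurable lebesgue"
  shows "ennreal (norm (higher_commutator m b (principal_value K) g x)) \<le> ennreal (c * Lip_norm \<delta> b ^ m) *
    (\<integral>\<^sup>+y. ennreal (norm (x - y) powr (m * \<delta> - CARD('n))) * ennreal (norm (g y)) \<partial>lebesgue)"
proof -
  define L where "L = Lip_norm \<delta> b"
  have L: "0 \<le> L" "\<And>x y. norm (b x - b y) \<le> L * norm (x - y) powr \<delta>"
    using Lip_norm_bound[OF b] by (auto simp: L_def)
  have pw: "norm (K x y * ((b x - b y) ^ m * g y))
      \<le> c * L ^ m * (norm (x - y) powr (m * \<delta> - CARD('n)) * norm (g y))" for y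
  proof (cases "x = y")
    case False
    have "norm (b x - b y) ^ m \<le> (L * norm (x - y) powr \<delta>) ^ m"
      using L by (intro power_mono) auto
    also have "\<dots> = L ^ m * norm (x - y) powr (m * \<delta>)"
      using False by (simp add: power_mult_distrib powr_power mult.commute)
    finally have "norm (K x y * ((b x - b y) ^ m * g y))
        \<le> norm (K x y) * (L ^ m * norm (x - y) powr (m * \<delta>) * norm (g y))"
      by (simp add: norm_mult norm_power mult_left_mono mult_right_mono)
    also have "\<dots> = L ^ m * norm (g y) * (norm (K x y) * norm (x - y) powr (m * \<delta>))"
      by (simp add: mult_ac)
    also have "\<dots> \<le> L ^ m * norm (g y) * (c * norm (x - y) powr (m * \<delta> - CARD('n)))"
      using False L by (intro mult_left_mono K) auto
    finally show ?thesis by (simp add: mult_ac)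
  \<comment> \<open>On the diagonal the kernel is not controlled, but the power of
    \<open>b x - b y\<close> vanishes there because \<open>m \<ge> 1\<close>.\<close>
  qed (use m in \<open>simp add: power_0_left\<close>)
  have "ennreal (norm (higher_commutator m b (principal_value K) g x))
      \<le> (\<integral>\<^sup>+y. ennreal (norm (K x y * ((b x - b y) ^ m * g y))) \<partial>lebesgue)"
    by (rule norm_higher_commutator_principal_value_le[where K = K and b = b and f = g and x = x, OF int])
  also have "\<dots> \<le> (\<integral>\<^sup>+y. ennreal (c * L ^ m) *
      (ennreal (norm (x - y) powr (m * \<delta> - CARD('n))) * ennreal (norm (g y))) \<partial>lebesgue)"
    using c L by (intro nn_integral_mono) (simp add: ennreal_mult[symmetric] ennreal_leI pw)
  also have "\<dots> = ennreal (c * L ^ m) *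
      (\<integral>\<^sup>+y. ennreal (norm (x - y) powr (m * \<delta> - CARD('n))) * ennreal (norm (g y)) \<partial>lebesgue)"
  proof (rule nn_integral_cmult)
    note [measurable] = fractional_kernel_measurable_section
    show "(\<lambda>y. ennreal (norm (x - y) powr (m * \<delta> - CARD('n))) * ennreal (norm (g y))) \<in> borel_measurable lebesgue"
      by measurable
  qed
  finally show ?thesis by (simp add: L_def)
qed

section \<open>From fractional integrals to the weighted commutator inequality\<close>

text \<open>The \<open>A_1\<close> bound for the ball of radius \<open>R\<close> around the origin,
  read as a lower bound for \<open>u y\<close>. It shows that a finite right-hand side of the
  theorem forces \<open>f v\<close> to be integrable.\<close>

lemma A1_weight_lower_bound:
  fixes u :: "real ^ 'n \<Rightarrow> real"
  assumes u: "A1_weight u" and R: "0 < R"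
  obtains e where "0 < e" and "AE y in lebesgue. norm y \<le> R \<longrightarrow> e \<le> u y"
proof -
  obtain C where C: "0 < C"
    and ball: "AE y in lebesgue. \<forall>z R. 0 < R \<longrightarrow> norm (z - y) \<le> R \<longrightarrow>
      (\<integral>\<^sup>+x\<in>cball z R. ennreal (u x) \<partial>lebesgue) \<le> ennreal (C * R ^ CARD('n) * u y)"
    using A1_weight_cball[OF u] by blast
  have wgt: "weight u" using u by (simp add: A1_weight_def)
  then have [measurable]: "u \<in> borel_measurable lebesgue"
    by (intro locally_integrable_measurable) (simp add: weight_def)
  have upos: "AE x in lebesgue. 0 < u x" using wgt by (simp add: weight_def)
  define p where "p = (\<integral>\<^sup>+x\<in>cball 0 R. ennreal (u x) \<partial>lebesgue)"
  have "p \<noteq> 0"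
  proof
    assume "p = 0"
    have [measurable]: "cball 0 R \<in> sets (lebesgue :: (real ^ 'n) measure)" by simp
    have "(\<lambda>x. ennreal (u x) * indicator (cball 0 R) x) \<in> borel_measurable lebesgue" by measurable
    with \<open>p = 0\<close> have "AE x in lebesgue. ennreal (u x) * indicator (cball 0 R) x = 0"
      by (simp add: p_def nn_integral_0_iff_AE)
    with upos have "AE x in lebesgue. x \<notin> cball (0 :: real ^ 'n) R"
      by eventually_elim (auto simp: indicator_def)
    then have "emeasure lebesgue (cball (0 :: real ^ 'n) R) = 0"
      by (subst (asm) AE_iff_measurable[of "cball 0 R"]) auto
    then have "measure lebesgue (cball (0 :: real ^ 'n) R) = 0" by (simp add: measure_def)
    then show False using content_cball_pos[OF R, of "0 :: real ^ 'n"] by simp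
  qed
  \<comment> \<open>The minimum with \<open>1\<close> yields a positive real number below
    \<open>p\<close> whether or not \<open>p\<close> is finite.\<close>
  define d where "d = enn2real (min 1 p)"
  have fin: "min 1 p < \<infinity>" by (simp add: min_less_iff_disj)
  then have d: "0 < d" "ennreal d \<le> p"
    using \<open>p \<noteq> 0\<close> by (auto simp: d_def enn2real_positive_iff zero_less_iff_neq_zero)
  have "AE y in lebesgue. norm y \<le> R \<longrightarrow> d / (C * R ^ CARD('n)) \<le> u y"
    using ball upos
  proof eventually_elim
    case (elim y)
    show ?case
    proof
      assume "norm y \<le> R"
      then have "p \<le> ennreal (C * R ^ CARD('n) * u y)"
        using elim R by (simp add: p_def)
      then have "ennreal d \<le> ennreal (C * R ^ CARD('n) * u y)" using d by simp
      then have "d \<le> C * R ^ CARD('n) * u y"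
        using elim C R by (simp add: ennreal_le_iff)
      then show "d / (C * R ^ CARD('n)) \<le> u y" using C R by (simp add: divide_le_eq mult.commute)
    qed
  qed
  then show ?thesis using that[of "d / (C * R ^ CARD('n))"] d C R by simp
qed

lemma ennreal_powr_mono:
  assumes "a \<le> b" "0 \<le> p"
  shows "ennreal_powr a p \<le> ennreal_powr b p"
proof (cases "b = \<infinity>")
  case False
  then have "a \<noteq> \<infinity>" "enn2real a \<le> enn2real b"
    using assms by (auto simp: top_unique less_top enn2real_mono)
  with False assms show ?thesis
    by (auto simp: ennreal_powr_def intro!: ennreal_leI powr_mono2)
qed (simp add: ennreal_powr_def)

lemma weighted_measure_mono_AE:
  assumes "AE x in lebesgue. x \<in> A \<longrightarrow> x \<in> B"
  shows "weighted_measure w A \<le> weighted_measure w B"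
  unfolding weighted_measure_def
  by (rule nn_integral_mono_AE, use assms in eventually_elim) (auto simp: indicator_def)

theorem theorem17:
  fixes m :: nat and \<delta> \<beta> q :: real
    and b :: "real ^ 'n \<Rightarrow> complex"
    and T :: "(real ^ 'n \<Rightarrow> complex) \<Rightarrow> real ^ 'n \<Rightarrow> complex"
    and u v :: "real ^ 'n \<Rightarrow> real"
  assumes "1 \<le> m"
    and "0 < \<delta>" and "\<delta> < min 1 (real CARD('n) / real m)"
    and "b \<in> Lip_space \<delta>"
    and "CZ_singular_integral_operator T"
    and "q = real CARD('n) / (real CARD('n) - real m * \<delta>)"
    and "A1_weight u"
    and "\<beta> < - real CARD('n)"
    and "v = (\<lambda>x. norm x powr \<beta>)"
  shows "\<exists>C>0. \<forall>t>0. \<forall>f :: real ^ 'n \<Rightarrow> complex.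
           f \<in> borel_measurable lebesgue \<longrightarrow> bounded (range f) \<longrightarrow> compact (supp f) \<longrightarrow>
           ennreal_powr
             (weighted_measure (\<lambda>x. u x * v x powr q)
               {x. norm (higher_commutator m b T (\<lambda>y. f y * of_real (v y)) x) / v x > t}) (1 / q)
           \<le> ennreal (C / t * Lip_norm \<delta> b ^ m) *
               (\<integral>\<^sup>+x. ennreal (norm (f x) * u x powr (1 / q) * v x) \<partial>lebesgue)"
proof -
  note m = assms(1) and \<delta>0 = assms(2) and \<delta>1 = assms(3) and b = assms(4) and v = assms(9)
  define n where "n = CARD('n)"
  have n1: "1 \<le> n" by (simp add: n_def Suc_leI)
  define \<alpha> where "\<alpha> = real m * \<delta>"
  have \<alpha>: "0 < \<alpha>" "\<alpha> < n" using m \<delta>0 \<delta>1 by (auto simp: \<alpha>_def n_def less_divide_eq mult.commute)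
  have "\<delta> < 1" using \<delta>1 by simp
  then have \<delta>n: "\<delta> < CARD('n)" using n1 unfolding n_def by linarith
  have q: "1 < q" using \<alpha> by (simp add: assms(6) \<alpha>_def n_def field_simps)
  obtain K where K: "standard_kernel K"
    and TK: "\<And>f. f \<in> borel_measurable lebesgue \<Longrightarrow> AE x in lebesgue. T f x = principal_value K f x"
    using assms(5) by (auto simp: CZ_singular_integral_operator_def CZ_operator_def)
  obtain c where c: "0 < c"
    and Kc: "\<And>x y s. x \<noteq> y \<Longrightarrow> norm (K x y) * norm (x - y) powr s \<le> c * norm (x - y) powr (s - CARD('n))"
    using standard_kernel_size[OF K] by blast
  obtain C where C: "0 < C" and weak: "\<And>t (g :: real ^ 'n \<Rightarrow> ennreal). 0 < t \<Longrightarrow> g \<in> borel_measurable lebesgue \<Longrightarrow>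
    ennreal_powr (weighted_measure (\<lambda>x. u x * (norm x powr \<beta>) powr q)
      {x. x \<noteq> 0 \<and> ennreal t < (\<integral>\<^sup>+y. ennreal (norm (x - y) powr (\<alpha> - CARD('n)) / norm x powr \<beta>) * g y \<partial>lebesgue)}) (1 / q)
    \<le> ennreal (C / t) * (\<integral>\<^sup>+y. ennreal (u y powr (1 / q)) * g y \<partial>lebesgue)"
    by (rule fractional_integral_weak_type[OF assms(7) \<alpha>(1) _ _ assms(8), of q])
      (use \<alpha>(2) assms(6) in \<open>simp_all only: n_def \<alpha>_def\<close>)
  define L where "L = Lip_norm \<delta> b"
  have L: "0 \<le> L" "\<And>x y. norm (b x - b y) \<le> L * norm (x - y) powr \<delta>"
    using Lip_norm_bound[OF b] by (auto simp: L_def)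
  have bm[measurable]: "b \<in> borel_measurable lebesgue"
    using b by (intro locally_integrable_measurable) (simp add: Lip_space_def)
  have vm[measurable]: "v \<in> borel_measurable lebesgue"
  proof -
    note [measurable] = measurable_lebesgue_ident
    show ?thesis unfolding v by measurable
  qed
  have v0: "0 \<le> v x" for x by (simp add: v)
  have um[measurable]: "u \<in> borel_measurable lebesgue"
    using assms(7) by (intro locally_integrable_measurable) (simp add: A1_weight_def weight_def)
  have "ennreal_powr
         (weighted_measure (\<lambda>x. u x * v x powr q)
           {x. norm (higher_commutator m b T (\<lambda>y. f y * of_real (v y)) x) / v x > t}) (1 / q)
       \<le> ennreal (C * c / t * L ^ m) *
           (\<integral>\<^sup>+x. ennreal (norm (f x) * u x powr (1 / q) * v x) \<partial>lebesgue)"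
    if t: "0 < t" and fm[measurable]: "f \<in> borel_measurable lebesgue"
      and fb: "bounded (range f)" and fs: "compact (supp f)" for t and f :: "real ^ 'n \<Rightarrow> complex"
  proof -
    define g where "g = (\<lambda>y. f y * of_real (v y))"
    have gm[measurable]: "g \<in> borel_measurable lebesgue" unfolding g_def by measurable
    define J where "J = (\<integral>\<^sup>+x. ennreal (norm (f x) * u x powr (1 / q) * v x) \<partial>lebesgue)"
    define A where "A = {x. norm (higher_commutator m b T g x) / v x > t}"
    have TH: "AE x in lebesgue. higher_commutator m b T g x = higher_commutator m b (principal_value K) g x"
      by (rule higher_commutator_cong_AE[OF TK bm gm])
    have "ennreal_powr (weighted_measure (\<lambda>x. u x * v x powr q) A) (1 / q) \<le> ennreal (C * c / t * L ^ m) * J"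
    \<comment> \<open>The rescaled level \<open>t'\<close> below divides by \<open>L ^ m\<close>. If
      \<open>L = 0\<close> then \<open>b\<close> is constant, and the commutator vanishes almost
      everywhere.\<close>
    proof (cases "L = 0")
      case True
      then have bc: "b = (\<lambda>_. b 0)" using L(2)[of _ 0] by (auto simp: fun_eq_iff)
      have "AE x in lebesgue. x \<in> A \<longrightarrow> x \<in> {}"
        using TH
      proof eventually_elim
        case (elim x)
        have "higher_commutator m b (principal_value K) g x = 0"
          by (subst bc) (rule higher_commutator_const_symbol[OF m])
        then show ?case using elim t by (simp add: A_def)
      qed
      then have "weighted_measure (\<lambda>x. u x * v x powr q) A \<le> weighted_measure (\<lambda>x. u x * v x powr q) {}"
        by (rule weighted_measure_mono_AE)
      then show ?thesis by (simp add: weighted_measure_def ennreal_powr_def)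
    next
      case False
      with L have Lpos: "0 < L" by simp
      show ?thesis
      \<comment> \<open>With \<open>L\<close> positive an infinite \<open>J\<close> makes the claim
        trivial; a finite \<open>J\<close> is what gives integrability of \<open>g\<close>, hence
        the pointwise bound of the commutator.\<close>
      proof (cases "J = \<infinity>")
        case True
        have "0 < C * c / t * L ^ m" using C c t Lpos by simp
        then have "ennreal (C * c / t * L ^ m) \<noteq> 0" by (simp only: ennreal_eq_0_iff not_le)
        then have "ennreal (C * c / t * L ^ m) * J = \<infinity>"
          using True by (simp only: ennreal_mult_eq_top_iff infinity_ennreal_def) blast
        then show ?thesis by simp
      next
        case False
        then have J: "J < \<infinity>" by (simp add: less_top)
        obtain R0 where R0: "\<And>y. y \<in> supp f \<Longrightarrow> norm y \<le> R0"
          using compact_imp_bounded[OF fs] by (auto simp: bounded_iff)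
        define R where "R = max R0 1"
        have R: "0 < R" by (simp add: R_def)
        have fR: "norm y \<le> R" if "f y \<noteq> 0" for y
        proof -
          have "y \<in> supp f" using that closure_subset by (force simp: supp_def)
          then show ?thesis using R0[of y] by (simp add: R_def)
        qed
        obtain e where e: "0 < e" "AE y in lebesgue. norm y \<le> R \<longrightarrow> e \<le> u y"
          using A1_weight_lower_bound[OF assms(7) R] by blast
        have "(\<integral>\<^sup>+y. ennreal (norm (g y)) \<partial>lebesgue)
            \<le> (\<integral>\<^sup>+y. ennreal (e powr - (1 / q)) * ennreal (norm (f y) * u y powr (1 / q) * v y) \<partial>lebesgue)"
        proof (rule nn_integral_mono_AE, use e(2) in eventually_elim)
          case (elim y)
          show ?case
          proof (cases "f y = 0")
            case False
            then have "e powr (1 / q) \<le> u y powr (1 / q)"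
              using elim fR e q by (intro powr_mono2) auto
            then have "1 \<le> e powr - (1 / q) * u y powr (1 / q)"
              using e by (simp add: powr_minus_divide le_divide_eq)
            then have "norm (f y) * v y * 1 \<le> norm (f y) * v y * (e powr - (1 / q) * u y powr (1 / q))"
              using v0 by (intro mult_left_mono) auto
            then have "norm (g y) \<le> e powr - (1 / q) * (norm (f y) * u y powr (1 / q) * v y)"
              using v0 by (simp add: g_def norm_mult mult_ac)
            then show ?thesis using v0 by (simp add: ennreal_mult[symmetric] ennreal_leI)
          qed (simp add: g_def)
        qed
        also have "\<dots> = ennreal (e powr - (1 / q)) * J"
          unfolding J_def by (rule nn_integral_cmult) measurable
        also have "\<dots> < \<infinity>" using J by (simp add: ennreal_mult_less_top)
        finally have gi: "integrable lebesgue g" by (intro integrableI_bounded gm)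
        have gR: "norm y \<le> R" if "g y \<noteq> 0" for y using fR that by (auto simp: g_def)
        \<comment> \<open>The constant of the pointwise commutator bound is absorbed into the level,
          so that \<open>C / t'\<close> becomes the constant claimed.\<close>
        define t' where "t' = t / (c * L ^ m)"
        have t': "0 < t'" using t c Lpos by (simp add: t'_def)
        define B where "B = {x. x \<noteq> 0 \<and> ennreal t' < (\<integral>\<^sup>+y. ennreal (norm (x - y) powr (\<alpha> - CARD('n)) / norm x powr \<beta>)
            * ennreal (norm (g y)) \<partial>lebesgue)}"
        have "AE x in lebesgue. \<forall>k. integrable lebesgue (\<lambda>y. K x y * ((b y ^ k - b x ^ k) * g y))"
          by (rule commutator_terms_integrable[OF K b \<delta>0 \<delta>n gi]) (rule gR)
        with TH have "AE x in lebesgue. x \<in> A \<longrightarrow> x \<in> B"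
        proof eventually_elim
          case (elim x)
          show ?case
          proof
            assume "x \<in> A"
            then have tH: "t < norm (higher_commutator m b T g x) / v x" by (simp add: A_def)
            \<comment> \<open>At the origin \<open>v\<close> is \<open>0\<close>, since
              \<open>0 powr \<beta> = 0\<close>, and the quotient is \<open>0\<close> by the
              convention for division; it cannot exceed \<open>t\<close>.\<close>
            then have x: "x \<noteq> 0" using t by (auto simp: v)
            then have vx: "0 < v x" by (simp add: v)
            define I where "I = (\<integral>\<^sup>+y. ennreal (norm (x - y) powr (\<alpha> - CARD('n))) * ennreal (norm (g y)) \<partial>lebesgue)"
            define F where "F = (\<integral>\<^sup>+y. ennreal (norm (x - y) powr (\<alpha> - CARD('n)) / norm x powr \<beta>)
                * ennreal (norm (g y)) \<partial>lebesgue)"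
            have "F = (\<integral>\<^sup>+y. ennreal (1 / v x) * (ennreal (norm (x - y) powr (\<alpha> - CARD('n))) * ennreal (norm (g y))) \<partial>lebesgue)"
              unfolding F_def using vx
              by (intro nn_integral_cong) (simp add: v ennreal_mult[symmetric])
            also have "\<dots> = ennreal (1 / v x) * I"
              unfolding I_def
            proof (rule nn_integral_cmult)
              note [measurable] = fractional_kernel_measurable_section
              show "(\<lambda>y. ennreal (norm (x - y) powr (\<alpha> - CARD('n))) * ennreal (norm (g y))) \<in> borel_measurable lebesgue"
                by measurable
            qed
            finally have F: "F = ennreal (1 / v x) * I" .
            have HI: "ennreal (norm (higher_commutator m b T g x)) \<le> ennreal (c * L ^ m) * I"
              unfolding elim(1) I_def L_def \<alpha>_def
              using elim(2) by (intro higher_commutator_le_fractional_integral[OF Kc c b m _ gm]) auto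
            have "ennreal t < ennreal (1 / v x) * ennreal (norm (higher_commutator m b T g x))"
              using tH t vx by (simp add: ennreal_mult[symmetric] ennreal_less_iff)
            also have "\<dots> \<le> ennreal (1 / v x) * (ennreal (c * L ^ m) * I)"
              by (intro mult_left_mono HI) simp
            also have "\<dots> = ennreal (c * L ^ m) * F" by (simp add: F mult_ac)
            finally have tF: "ennreal t < ennreal (c * L ^ m) * F" .
            have "ennreal t' < F"
            proof (rule ccontr)
              assume "\<not> ennreal t' < F"
              then have "ennreal (c * L ^ m) * F \<le> ennreal (c * L ^ m) * ennreal t'"
                by (intro mult_left_mono) auto
              also have "\<dots> = ennreal t"
                using c Lpos t' by (subst ennreal_mult[symmetric]) (auto simp: t'_def)
              finally show False using tF by simp
            qed
            then show "x \<in> B" using x by (simp add: B_def F_def)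
          qed
        qed
        then have "ennreal_powr (weighted_measure (\<lambda>x. u x * v x powr q) A) (1 / q)
            \<le> ennreal_powr (weighted_measure (\<lambda>x. u x * v x powr q) B) (1 / q)"
          using q by (intro ennreal_powr_mono weighted_measure_mono_AE) auto
        also have "\<dots> \<le> ennreal (C / t') * (\<integral>\<^sup>+y. ennreal (u y powr (1 / q)) * ennreal (norm (g y)) \<partial>lebesgue)"
          unfolding B_def v by (rule weak[OF t']) measurable
        also have "(\<integral>\<^sup>+y. ennreal (u y powr (1 / q)) * ennreal (norm (g y)) \<partial>lebesgue) = J"
          unfolding J_def g_def using v0
          by (intro nn_integral_cong) (simp add: ennreal_mult[symmetric] norm_mult mult_ac)
        also have "C / t' = C * c / t * L ^ m" by (simp add: t'_def)
        finally show ?thesis .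
      qed
    qed
    then show ?thesis by (simp add: A_def g_def J_def)
  qed
  then show ?thesis
    using C c by (intro exI[of _ "C * c"]) (auto simp: L_def)
qed

end
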